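(* Fix integers $2\le r\le k$. There is a constant $c=c(k,r)>0$ such that every $k$-uniform hypergraph $H$ on $n$ vertices with no isolated vertices has an $r$-cut with excess at least $cn$. In particular, if $k>2$, then every such $H$ has a $2$-cut with excess at least $n/(k2^{k-1})$; this is best possible, since for a $k$-uniform perfect matching on $n$ vertices the maximum excess of a $2$-cut equals $n/(k2^{k-1})$.
   Context: For $2\le r\le k$, an $r$-cut of a $k$-uniform hypergraph $H$ is a partition of $V(H)$ into $r$ labelled parts; its size is the number of edges having a vertex in every part. The excess of an $r$-cut of an $m$-edge $k$-uniform hypergraph is its size minus $\frac{S(k,r)r!}{r^k}m$, where $S(k,r)$ is the Stirling number of the second kind (for $r=2$ this is $(1-2^{1-k})m$). A vertex is isolated if it lies in no edge. A $k$-uniform perfect matching is a $k$-uniform hypergraph in which every vertex lies in exactly one edge. *)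

theory Defs
  imports Complex_Main "HOL-Library.Disjoint_Sets" "HOL-Combinatorics.Stirling"
begin

definition uniform_hypergraph :: "nat \<Rightarrow> 'a set \<Rightarrow> 'a set set \<Rightarrow> bool" where
  "uniform_hypergraph k V E \<longleftrightarrow> finite V \<and> (\<forall>e\<in>E. e \<subseteq> V \<and> card e = k)"

definition isolated :: "'a set set \<Rightarrow> 'a \<Rightarrow> bool" where
  "isolated E v \<longleftrightarrow> (\<forall>e\<in>E. v \<notin> e)"

definition perfect_matching :: "nat \<Rightarrow> 'a set \<Rightarrow> 'a set set \<Rightarrow> bool" where
  "perfect_matching k V E \<longleftrightarrow> uniform_hypergraph k V E \<and> (\<forall>v\<in>V. \<exists>!e. e \<in> E \<and> v \<in> e)"

text \<open>The labels are \<open>0, \<dots>, r - 1\<close>. Parts may be empty, as is usual for cuts; only so does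
  the hypergraph without vertices have a cut. A cut with an empty part has size \<open>0\<close>. The values
  \<open>P i\<close> for \<open>i \<ge> r\<close> are irrelevant.\<close>

definition is_cut :: "nat \<Rightarrow> 'a set \<Rightarrow> (nat \<Rightarrow> 'a set) \<Rightarrow> bool" where
  "is_cut r V P \<longleftrightarrow> disjoint_family_on P {..<r} \<and> (\<Union>i<r. P i) = V"

definition cut_size :: "nat \<Rightarrow> 'a set set \<Rightarrow> (nat \<Rightarrow> 'a set) \<Rightarrow> nat" where
  "cut_size r E P = card {e \<in> E. \<forall>i<r. e \<inter> P i \<noteq> {}}"

definition excess :: "nat \<Rightarrow> nat \<Rightarrow> 'a set set \<Rightarrow> (nat \<Rightarrow> 'a set) \<Rightarrow> real" where
  "excess k r E P =
     real (cut_size r E P) - real (Stirling k r) * fact r / real r ^ k * real (card E)"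

text \<open>The set below is finite and nonempty when \<open>E\<close> is finite and \<open>r > 0\<close>, since \<open>cut_size\<close>
  takes values in \<open>{0..card E}\<close>.\<close>

definition max_excess :: "nat \<Rightarrow> nat \<Rightarrow> 'a set \<Rightarrow> 'a set set \<Rightarrow> real" where
  "max_excess k r V E = Max {excess k r E P | P. is_cut r V P}"

end

theory Submission
  imports Defs
begin

text \<open>
  Call two vertices adjacent if some edge contains both. Take pairwise disjoint induced stars in this
  graph, and colour the vertices at random with \<open>r\<close> colours, the only constraint being that each leaf
  differs from its centre. Two leaves of one star never share an edge, so an edge which is not split,
  that is, contains no leaf together with its centre, is coloured uniformly and is cut with the usual
  probability. Every further constraint inside an edge only helps, and the first one raises the
  probability by at least \<open>r\<^sup>1\<^sup>-\<^sup>k / (r - 1)\<close>, which is \<open>2\<^sup>1\<^sup>-\<^sup>k\<close> for \<open>r = 2\<close>. It remains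
  to choose the stars so that at least \<open>n / max k 3\<close> edges are split. Take as many vertices in stars as
  possible and, subject to this, as many vertices in split edges as possible. A vertex \<open>v\<close> in no split
  edge is then adjacent to both vertices of a star with a single leaf, no other vertex outside the
  stars is adjacent to these two, and an edge through this star contains no other leaf with its centre.
  Charging \<open>v\<close> to that edge, no edge is charged more than \<open>max k 3\<close> times.
\<close>

subsection \<open>Star packings\<close>

definition adj :: "'a set set \<Rightarrow> 'a \<Rightarrow> 'a \<Rightarrow> bool" where
  "adj E u v \<longleftrightarrow> u \<noteq> v \<and> (\<exists>e\<in>E. u \<in> e \<and> v \<in> e)"

text \<open>A star packing is given by the map \<open>p\<close> sending a leaf to the centre of its star and fixing
  all other vertices.\<close>

definition star_packing :: "'a set \<Rightarrow> 'a set set \<Rightarrow> ('a \<Rightarrow> 'a) \<Rightarrow> bool" where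
  "star_packing V E p \<longleftrightarrow>
     (\<forall>v\<in>V. p v \<in> V \<and> p (p v) = p v \<and> (p v \<noteq> v \<longrightarrow> adj E v (p v))) \<and>
     (\<forall>u\<in>V. \<forall>v\<in>V. p u \<noteq> u \<longrightarrow> p v \<noteq> v \<longrightarrow> p u = p v \<longrightarrow> \<not> adj E u v)"

text \<open>A nontrivial fibre of \<open>p\<close> is the vertex set of a star, so leaves and
  centres are treated alike; vertices outside all stars have singleton fibres.\<close>

definition starred :: "'a set \<Rightarrow> ('a \<Rightarrow> 'a) \<Rightarrow> 'a set" where
  "starred V p = {v \<in> V. \<exists>u\<in>V. u \<noteq> v \<and> p u = p v}"

definition split_edges :: "'a set set \<Rightarrow> ('a \<Rightarrow> 'a) \<Rightarrow> 'a set set" where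
  "split_edges E p = {e \<in> E. \<exists>u\<in>e. p u \<noteq> u \<and> p u \<in> e}"

section \<open>Attaching and releasing leaves\<close>

lemma adj_commute: "adj E u v \<longleftrightarrow> adj E v u"
  by (auto simp: adj_def)

lemma star_packing_id: "star_packing V E (\<lambda>v. v)"
  by (simp add: star_packing_def)

text \<open>The fibre of \<open>v\<close> is a singleton, so moving \<open>v\<close> into the fibre
  of \<open>c\<close> takes a partner from no other vertex.\<close>

lemma starred_attach:
  assumes "star_packing V E p" "v \<in> V" "v \<notin> starred V p" "c \<in> V" "p c = c" "c \<noteq> v"
  shows "starred V (p(v := c)) = insert v (insert c (starred V p))"
proof -
  have alone: "p u \<noteq> p v" if "u \<in> V" "u \<noteq> v" for u using assms(2,3) that by (auto simp: starred_def)
  show ?thesis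
  proof (intro equalityI subsetI)
    fix x assume x: "x \<in> starred V (p(v := c))"
    then obtain u where u: "u \<in> V" "u \<noteq> x" "(p(v := c)) u = (p(v := c)) x" "x \<in> V"
      by (auto simp: starred_def)
    show "x \<in> insert v (insert c (starred V p))"
    proof (cases "x = v \<or> x = c")
      case False
      \<comment> \<open>If the new partner of \<open>x\<close> is \<open>v\<close>, then
        \<open>x\<close> lies over \<open>c\<close>, and \<open>c\<close> was already its
        partner.\<close>
      let ?u = "if u = v then c else u"
      have "?u \<noteq> x \<and> p ?u = p x \<and> ?u \<in> V"
        using u False assms(4,5) by (cases "u = v") auto
      then show ?thesis unfolding starred_def using u(4) by blast
    next
      case True
      then show ?thesis by blast
    qed
  next
    fix x assume x: "x \<in> insert v (insert c (starred V p))"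
    show "x \<in> starred V (p(v := c))"
    proof (cases "x = v \<or> x = c")
      case True
      then have "x \<in> V \<and> (\<exists>u\<in>V. u \<noteq> x \<and> (p(v := c)) u = (p(v := c)) x)"
      proof
        assume "x = v"
        then show ?thesis using assms(2,4,5,6) by (intro conjI bexI[of _ c]) auto
      next
        assume "x = c"
        then show ?thesis using assms(2,4,5,6) by (intro conjI bexI[of _ v]) auto
      qed
      then show ?thesis by (simp add: starred_def)
    next
      case False
      then obtain u where u: "u \<in> V" "u \<noteq> x" "p u = p x" "x \<in> V" using x by (auto simp: starred_def)
      then have "u \<noteq> v" using alone[of x] False by auto
      then have "(p(v := c)) u = (p(v := c)) x" using u False by simp
      then show ?thesis unfolding starred_def using u by blast
    qed
  qed
qed

lemma leaf_starred:
  assumes "star_packing V E p" "w \<in> V" "p w \<noteq> w"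
  shows "w \<in> starred V p" "p w \<in> starred V p"
proof -
  have pw: "p w \<in> V" "p (p w) = p w" using assms by (auto simp: star_packing_def)
  show "w \<in> starred V p"
    unfolding starred_def using assms(2,3) pw by (auto intro!: bexI[of _ "p w"])
  show "p w \<in> starred V p"
    unfolding starred_def using assms(2,3) pw by (auto intro!: bexI[of _ w])
qed

text \<open>Here \<open>c\<close> is the centre of a star or an unstarred vertex that becomes a
  centre. Being unstarred, \<open>v\<close> is the image of no other vertex, so the new map is still
  idempotent; the condition on the leaves of \<open>c\<close> keeps its star induced.\<close>

lemma star_packing_attach:
  assumes p: "star_packing V E p" and v: "v \<in> V" "v \<notin> starred V p"
    and c: "c \<in> V" "p c = c" "adj E v c"
    and leaves: "\<And>w. w \<in> V \<Longrightarrow> p w = c \<Longrightarrow> w \<noteq> c \<Longrightarrow> \<not> adj E w v"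
  shows "star_packing V E (p(v := c))"
proof -
  have vc: "v \<noteq> c" using c(3) by (auto simp: adj_def)
  have u: "u = v" if "u \<in> V" "p u = p v" for u using v that by (auto simp: starred_def)
  have pv: "p v = v" using u[of "p v"] p v(1) by (auto simp: star_packing_def)
  have pu: "p u \<noteq> v" if "u \<in> V" "u \<noteq> v" for u using u[of u] pv that by metis
  have P: "p x \<in> V" "p (p x) = p x" "p x \<noteq> x \<Longrightarrow> adj E x (p x)" if "x \<in> V" for x
    using p that by (auto simp: star_packing_def)
  have Q: "\<not> adj E x y" if "x \<in> V" "y \<in> V" "p x \<noteq> x" "p y \<noteq> y" "p x = p y" for x y
    using p that by (auto simp: star_packing_def)
  let ?q = "p(v := c)"
  have "?q x \<in> V \<and> ?q (?q x) = ?q x \<and> (?q x \<noteq> x \<longrightarrow> adj E x (?q x))" if "x \<in> V" for x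
    using P[OF that] pu[OF that] that c vc by (cases "x = v") auto
  moreover have "\<not> adj E x y" if "x \<in> V" "y \<in> V" "?q x \<noteq> x" "?q y \<noteq> y" "?q x = ?q y" for x y
  proof (cases "x = v")
    case True
    show ?thesis
    proof (cases "y = v")
      case True
      then show ?thesis using \<open>x = v\<close> by (simp add: adj_def)
    next
      case False
      then have "\<not> adj E y v" using True that leaves[of y] by auto
      then show ?thesis using True adj_commute by metis
    qed
  next
    case False
    then show ?thesis using Q[of x y] leaves[of x] that by (cases "y = v") auto
  qed
  ultimately show ?thesis unfolding star_packing_def by blast
qed

lemma unstarred_fixed: "star_packing V E p \<Longrightarrow> v \<in> V \<Longrightarrow> v \<notin> starred V p \<Longrightarrow> p v = v"
  using leaf_starred(1) by metis

text \<open>A leaf is no vertex's centre, so releasing it changes no other leaf-centre pair.\<close>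

lemma star_packing_detach:
  assumes "star_packing V E p" "p w \<noteq> w"
  shows "star_packing V E (p(w := w))"
proof -
  have "p x \<noteq> w" if "x \<in> V" for x using assms that unfolding star_packing_def by metis
  then show ?thesis using assms unfolding star_packing_def by simp blast
qed

text \<open>Only the released leaf and its centre can leave the starred set. The leaf does; whether
  the centre does depends on whether the star has another leaf, which the last two parts
  distinguish.\<close>

lemma starred_detach:
  assumes "star_packing V E p" "w \<in> V" "p w \<noteq> w"
  shows "starred V p - {w, p w} \<subseteq> starred V (p(w := w))"
    and "starred V (p(w := w)) \<subseteq> starred V p - {w}"
    and "u \<in> V \<Longrightarrow> u \<noteq> w \<Longrightarrow> p u = p w \<Longrightarrow> p u \<noteq> u \<Longrightarrow> p w \<in> starred V (p(w := w))"
    and "(\<And>u. u \<in> V \<Longrightarrow> p u = p w \<Longrightarrow> u = w \<or> u = p w) \<Longrightarrow> p w \<notin> starred V (p(w := w))"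
proof -
  have *: "p x \<noteq> w" if "x \<in> V" for x using that assms unfolding star_packing_def by metis
  show "starred V p - {w, p w} \<subseteq> starred V (p(w := w))"
  proof
    fix x assume x: "x \<in> starred V p - {w, p w}"
    then obtain u where u: "u \<in> V" "u \<noteq> x" "p u = p x" and xV: "x \<in> V" by (auto simp: starred_def)
    show "x \<in> starred V (p(w := w))"
    proof (cases "u = w")
      \<comment> \<open>Another leaf \<open>x\<close> of the same star still has the centre as a
        partner.\<close>
      case True
      then have "p w \<in> V" "p (p w) = p w" "p w \<noteq> x" using assms x by (auto simp: star_packing_def)
      then show ?thesis using True u xV x assms(3) by (auto simp: starred_def)
    next
      case False
      then show ?thesis using u xV x by (auto simp: starred_def)
    qed
  qed
  show "starred V (p(w := w)) \<subseteq> starred V p - {w}"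
    using * assms by (auto simp: starred_def split: if_splits)
  show "p w \<in> starred V (p(w := w))" if "u \<in> V" "u \<noteq> w" "p u = p w" "p u \<noteq> u"
    using that assms by (auto simp: starred_def star_packing_def)
  show "p w \<notin> starred V (p(w := w))" if "\<And>u. u \<in> V \<Longrightarrow> p u = p w \<Longrightarrow> u = w \<or> u = p w"
    using that assms * by (auto simp: starred_def star_packing_def split: if_splits)
qed

lemma starred_subset: "starred V p \<subseteq> V" by (auto simp: starred_def)

lemma split_edgesI: "e \<in> E \<Longrightarrow> u \<in> e \<Longrightarrow> p u \<noteq> u \<Longrightarrow> p u \<in> e \<Longrightarrow> e \<in> split_edges E p"
  by (auto simp: split_edges_def)

lemma starred_split_edge:
  assumes p: "star_packing V E p" and v: "v \<in> starred V p"
  obtains u e where "u \<in> V" "p u \<noteq> u" "v = u \<or> v = p u" "e \<in> E" "u \<in> e" "p u \<in> e" 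
proof -
  obtain u where u: "u \<in> V" "u \<noteq> v" "p u = p v" and vV: "v \<in> V" using v by (auto simp: starred_def)
  obtain w where w: "w \<in> V" "p w \<noteq> w" "v = w \<or> v = p w"
  proof (cases "p v = v")
    case True
    then show ?thesis using that[of u] u by simp
  next
    case False
    then show ?thesis using that[of v] vV by simp
  qed
  then have "adj E w (p w)" using p by (auto simp: star_packing_def)
  then show ?thesis using that w by (auto simp: adj_def)
qed

lemma starred_subset_covered:
  assumes p: "star_packing V E p"
  shows "starred V p \<subseteq> \<Union> (split_edges E p)"
proof
  fix v assume "v \<in> starred V p"
  then obtain u e where "u \<in> V" "p u \<noteq> u" "v = u \<or> v = p u" "e \<in> E" "u \<in> e" "p u \<in> e"
    by (rule starred_split_edge[OF p])
  then show "v \<in> \<Union> (split_edges E p)" by (intro UnionI[of e] split_edgesI[of e E u]) auto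
qed

section \<open>Optimal packings and the number of split edges\<close>

locale hypergraph =
  fixes k :: nat and V :: "'a set" and E :: "'a set set"
  assumes uniform: "uniform_hypergraph k V E"
    and no_isolated: "v \<in> V \<Longrightarrow> \<not> isolated E v"
    and k_ge_2: "2 \<le> k"
begin

lemma finite_V: "finite V" and edge_subset: "e \<in> E \<Longrightarrow> e \<subseteq> V" and card_edge: "e \<in> E \<Longrightarrow> card e = k"
  using uniform by (auto simp: uniform_hypergraph_def)

lemma finite_E: "finite E"
  by (rule finite_subset[of _ "Pow V"]) (use finite_V edge_subset in auto)

lemma finite_edge: "e \<in> E \<Longrightarrow> finite e"
  using finite_V edge_subset finite_subset by blast

lemma adj_in_V: "adj E u v \<Longrightarrow> u \<in> V" "adj E u v \<Longrightarrow> v \<in> V"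
  using edge_subset by (auto simp: adj_def)

lemma ex_adj:
  assumes "v \<in> V"
  obtains u where "adj E v u"
proof -
  obtain e where e: "e \<in> E" "v \<in> e" using no_isolated[OF assms] by (auto simp: isolated_def)
  have "\<not> e \<subseteq> {v}" using card_edge[OF e(1)] k_ge_2 card_mono[of "{v}" e] by auto
  then obtain u where "u \<in> e" "u \<noteq> v" by auto
  then show ?thesis using that[of u] e by (auto simp: adj_def)
qed

text \<open>The exchanges below contradict the first criterion, except the one in
  \<open>triangle_edge\<close>: there the number of starred vertices stays the same and the second
  criterion decides.\<close>

definition optimal :: "('a \<Rightarrow> 'a) \<Rightarrow> bool" where
  "optimal p \<longleftrightarrow> star_packing V E p \<and>
     (\<forall>q. star_packing V E q \<longrightarrow> card (starred V q) \<le> card (starred V p) \<and>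
        (card (starred V q) = card (starred V p) \<longrightarrow>
           card (\<Union> (split_edges E q)) \<le> card (\<Union> (split_edges E p))))"

lemma ex_optimal: "\<exists>p. optimal p"
proof -
  have cov: "card (\<Union> (split_edges E q)) < Suc (card V)" for q
    using edge_subset finite_V by (intro le_imp_less_Suc card_mono) (auto simp: split_edges_def)
  have st: "card (starred V q) < Suc (card V)" for q
    using finite_V by (intro le_imp_less_Suc card_mono) (auto simp: starred_def)
  obtain p where p: "star_packing V E p"
    "\<And>q. star_packing V E q \<Longrightarrow> card (starred V q) \<le> card (starred V p)"
    using ex_has_greatest_nat[of "star_packing V E" "\<lambda>v. v" "\<lambda>q. card (starred V q)" "Suc (card V)"]
      st star_packing_id by blast
  obtain p' where p': "star_packing V E p' \<and> card (starred V p') = card (starred V p)"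
    "\<And>q. star_packing V E q \<and> card (starred V q) = card (starred V p) \<Longrightarrow>
       card (\<Union> (split_edges E q)) \<le> card (\<Union> (split_edges E p'))"
    using ex_has_greatest_nat[of "\<lambda>q. star_packing V E q \<and> card (starred V q) = card (starred V p)" p
        "\<lambda>q. card (\<Union> (split_edges E q))" "Suc (card V)"]
      cov p by blast
  then show ?thesis using p(2) unfolding optimal_def by (intro exI[of _ p']) simp
qed

context
  fixes p assumes opt: "optimal p"
begin

lemma packing: "star_packing V E p" 
  using opt by (simp add: optimal_def)

lemma starred_not_psubset: 
  assumes "star_packing V E q" "starred V p \<subseteq> starred V q" shows "starred V q = starred V p"
proof (rule card_seteq[symmetric])
  show "finite (starred V q)" using finite_subset[OF starred_subset finite_V] .
  show "card (starred V q) \<le> card (starred V p)" using assms(1) opt by (simp add: optimal_def)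
qed (fact assms(2))

text \<open>Release \<open>w\<close> and make it the centre of a new star with leaf
  \<open>v\<close>. If the old star had another leaf, its centre would stay starred and
  \<open>v\<close> would be gained. If \<open>v\<close> were not adjacent to the old centre
  \<open>p w\<close>, this centre could become a second leaf of \<open>w\<close>, and again
  \<open>v\<close> would be gained.\<close>

lemma single_triangle:
  assumes v: "v \<in> V" "v \<notin> starred V p" and wV: "w \<in> V" and pw: "p w \<noteq> w" and adj: "adj E v w"
  shows "u \<in> V \<Longrightarrow> p u = p w \<Longrightarrow> u = w \<or> u = p w" and "adj E v (p w)"
proof -
  let ?q = "p(w := w)"
  have wv: "w \<noteq> v" using adj by (auto simp: adj_def)
  have q: "star_packing V E ?q" using star_packing_detach[OF packing pw] .
  have nw: "p x \<noteq> w" if "x \<in> V" for x using packing that pw by (auto simp: star_packing_def)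
  have vq: "v \<notin> starred V ?q" using starred_detach(2)[OF packing wV pw] v by auto
  have q2: "star_packing V E (?q(v := w))"
    using nw pw wV adj by (intro star_packing_attach q v(1) vq) auto
  have S2: "starred V (?q(v := w)) = insert v (insert w (starred V ?q))"
    using wv wV by (intro starred_attach[OF q v(1) vq]) auto
  show two: "u = w \<or> u = p w" if u: "u \<in> V" "p u = p w" for u
  proof (rule ccontr)
    assume *: "\<not> ?thesis"
    then have "p w \<in> starred V ?q" using starred_detach(3)[OF packing wV pw, of u] u by auto
    then have "starred V p \<subseteq> starred V (?q(v := w))" using S2 starred_detach(1)[OF packing wV pw] by auto
    then show False using starred_not_psubset[OF q2] S2 v by auto
  qed
  show "adj E v (p w)"
  proof (rule ccontr)
    assume *: "\<not> ?thesis"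
    have c: "p w \<in> V" "p (p w) = p w" "adj E w (p w)" using packing wV pw by (auto simp: star_packing_def)
    have cv: "p w \<noteq> v" using c wV pw v by (auto simp: starred_def)
    have cq: "p w \<notin> starred V (?q(v := w))" 
      using S2 two cv pw starred_detach(4)[OF packing wV pw] by auto
    let ?q3 = "?q(v := w, p w := w)"
    have q3: "star_packing V E ?q3"
    proof (rule star_packing_attach[OF q2 c(1) cq wV])
      show "(?q(v := w)) w = w" by simp
      show "adj E (p w) w" using c(3) by (subst adj_commute)
      \<comment> \<open>No vertex had \<open>w\<close> as its centre before, so \<open>v\<close> is
        its only leaf, and inducedness reduces to the assumed nonadjacency of \<open>v\<close> and
        \<open>p w\<close>.\<close>
      show "\<not> adj E x (p w)" if "x \<in> V" "(?q(v := w)) x = w" "x \<noteq> w" for x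
        using that * nw[of x] by (auto split: if_splits)
    qed
    have S3: "starred V ?q3 = insert (p w) (insert w (starred V (?q(v := w))))"
      using pw wV by (intro starred_attach[OF q2 c(1) cq]) auto
    then have "starred V p \<subseteq> starred V ?q3" using S2 starred_detach(1)[OF packing wV pw] by auto
    then show False using starred_not_psubset[OF q3] S2 S3 v by auto
  qed
qed

text \<open>Otherwise the star on \<open>w\<close> and \<open>p w\<close> could be replaced by two
  stars, \<open>v\<close> attached to \<open>w\<close> and \<open>x\<close> attached to
  \<open>p w\<close>, gaining \<open>v\<close> and \<open>x\<close> at no loss.\<close>

lemma single_unique:
  assumes v: "v \<in> V" "v \<notin> starred V p" and wV: "w \<in> V" and pw: "p w \<noteq> w" and adj: "adj E v w"
    and x: "x \<in> V" "x \<notin> starred V p" "adj E x (p w)"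
  shows "x = v"
proof (rule ccontr)
  assume xv: "x \<noteq> v"
  let ?q = "p(w := w)"
  have wv: "w \<noteq> v" using adj by (auto simp: adj_def)
  have q: "star_packing V E ?q" using star_packing_detach[OF packing pw] .
  have nw: "p x \<noteq> w" if "x \<in> V" for x using packing that pw by (auto simp: star_packing_def)
  have c: "p w \<in> V" "p (p w) = p w" "adj E w (p w)" using packing wV pw by (auto simp: star_packing_def)
  note wS = leaf_starred(1)[OF packing wV pw]
  have vq: "v \<notin> starred V ?q" "x \<notin> starred V ?q" using starred_detach(2)[OF packing wV pw] v x by auto
  have q2: "star_packing V E (?q(v := w))"
    using nw pw wV adj by (intro star_packing_attach q v(1) vq) auto
  have S2: "starred V (?q(v := w)) = insert v (insert w (starred V ?q))"
    using wv wV by (intro starred_attach[OF q v(1) vq(1)]) auto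
  have xq: "x \<notin> starred V (?q(v := w))" using S2 vq xv x wS by auto
  have cv: "p w \<noteq> v" using c wV pw v by (auto simp: starred_def)
  have cq: "(?q(v := w)) (p w) = p w" using cv pw c by simp
  let ?q3 = "?q(v := w, x := p w)"
  have q3: "star_packing V E ?q3"
  proof (rule star_packing_attach[OF q2 x(1) xq c(1) cq x(3)])
    \<comment> \<open>By \<open>single_triangle\<close> the centre \<open>p w\<close> has lost its
      only leaf, so there is no \<open>y\<close> to check.\<close>
    show "\<not> adj E y x" if "y \<in> V" "(?q(v := w)) y = p w" "y \<noteq> p w" for y
      using that single_triangle(1)[OF v wV pw adj, of y] pw by (auto split: if_splits)
  qed
  have "p w \<noteq> x" using x(3) by (auto simp: adj_def)
  then have S3: "starred V ?q3 = insert x (insert (p w) (starred V (?q(v := w))))"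
    by (rule starred_attach[OF q2 x(1) xq c(1) cq])
  then have "starred V p \<subseteq> starred V ?q3" using S2 starred_detach(1)[OF packing wV pw] by auto
  then show False using starred_not_psubset[OF q3] S2 S3 v by auto
qed

text \<open>A neighbour \<open>u\<close> of \<open>v\<close> is either a leaf or fixed by
  \<open>p\<close>. In the second case maximality forbids attaching \<open>v\<close> to
  \<open>u\<close>, and only a leaf of \<open>u\<close> adjacent to \<open>v\<close> can be the
  obstacle.\<close>

lemma ex_triangle:
  assumes v: "v \<in> V" "v \<notin> starred V p"
  obtains w where "w \<in> V" "p w \<noteq> w" "adj E v w"
proof -
  obtain u where u: "adj E v u" using ex_adj[OF v(1)] by blast
  then have uV: "u \<in> V" "u \<noteq> v" using adj_in_V by (auto simp: adj_def)
  show ?thesis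
  proof (cases "p u = u")
    case False
    then show ?thesis using that[OF uV(1)] u by simp
  next
    case True
    show ?thesis
    proof (cases "\<exists>w\<in>V. p w = u \<and> w \<noteq> u \<and> adj E w v")
      case True
      then obtain w where w: "w \<in> V" "p w = u" "w \<noteq> u" "adj E w v" by blast
      then have "adj E v w" by (subst adj_commute)
      then show ?thesis using that[of w] w by simp
    next
      case False
      have "star_packing V E (p(v := u))"
        by (rule star_packing_attach[OF packing v uV(1) True u]) (use False in blast)
      moreover have "starred V (p(v := u)) = insert v (insert u (starred V p))"
        using uV True by (intro starred_attach[OF packing v]) auto
      ultimately show ?thesis using starred_not_psubset[of "p(v := u)"] v by auto
    qed
  qed
qed

text \<open>An unstarred vertex of \<open>f\<close> is adjacent to \<open>p w\<close>, hence equal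
  to \<open>v\<close>, but \<open>v\<close> lies in no split edge. If \<open>f\<close> contained a
  second leaf \<open>y\<close> with its centre, exchange the star on \<open>w\<close> and
  \<open>p w\<close> for the star with centre \<open>w\<close> and leaf \<open>v\<close>. The number
  of starred vertices is unchanged, no covered vertex becomes uncovered, and \<open>v\<close>
  becomes covered, against the second criterion.\<close>

lemma triangle_edge:
  assumes v: "v \<in> V" "v \<notin> \<Union> (split_edges E p)" and wV: "w \<in> V" and pw: "p w \<noteq> w" and adj: "adj E v w"
    and f: "f \<in> E" "w \<in> f" "p w \<in> f"
  shows "x \<in> f \<Longrightarrow> x \<in> starred V p" and "y \<in> f \<Longrightarrow> p y \<noteq> y \<Longrightarrow> p y \<in> f \<Longrightarrow> y = w"
proof -
  have vS: "v \<notin> starred V p" using starred_subset_covered[OF packing] v(2) by blast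
  note tri = single_triangle[OF v(1) vS wV pw adj]
  note uni = single_unique[OF v(1) vS wV pw adj]
  \<comment> \<open>Stated for every edge \<open>g\<close> through \<open>w\<close> and
    \<open>p w\<close>, since the exchange below also concerns edges other than
    \<open>f\<close>.\<close>
  have st: "x \<in> starred V p" if x: "x \<in> g" "g \<in> E" "w \<in> g" "p w \<in> g" for x g
  proof (rule ccontr)
    assume *: "x \<notin> starred V p"
    have xV: "x \<in> V" using x edge_subset by auto
    have "p w \<in> starred V p" using leaf_starred[OF packing wV pw] by simp
    then have "adj E x (p w)" using x * by (auto simp: adj_def)
    with xV * have "x = v" by (rule uni)
    moreover have "g \<in> split_edges E p" using x pw by (intro split_edgesI[of g E w]) auto
    ultimately show False using x(1) v(2) by blast
  qed
  show "x \<in> f \<Longrightarrow> x \<in> starred V p" using st[OF _ f] .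
  show "y = w" if y: "y \<in> f" "p y \<noteq> y" "p y \<in> f"
  proof (rule ccontr)
    assume yw: "y \<noteq> w"
    let ?q = "p(w := w)" let ?q2 = "?q(v := w)"
    have wv: "w \<noteq> v" using adj by (auto simp: adj_def)
    have q: "star_packing V E ?q" using star_packing_detach[OF packing pw] .
    have nw: "p x \<noteq> w" if "x \<in> V" for x using packing that pw by (auto simp: star_packing_def)
    note wS = leaf_starred[OF packing wV pw]
    have vq: "v \<notin> starred V ?q" using starred_detach(2)[OF packing wV pw] vS by auto
    have q2: "star_packing V E ?q2"
      by (rule star_packing_attach[OF q v(1) vq wV _ adj]) (use nw in \<open>auto split: if_splits\<close>)
    have "starred V ?q2 = insert v (insert w (starred V ?q))"
      using wv wV by (intro starred_attach[OF q v(1) vq]) auto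
    also have "starred V ?q = starred V p - {w, p w}"
      using starred_detach(1,2)[OF packing wV pw] starred_detach(4)[OF packing wV pw tri(1)] by blast
    also have "insert v (insert w (starred V p - {w, p w})) = insert v (starred V p - {p w})"
      using wS(1) pw by blast
    finally have S2: "starred V ?q2 = insert v (starred V p - {p w})" .
    have pv: "p v = v" using unstarred_fixed[OF packing v(1) vS] .
    have fin: "finite (starred V p)" using finite_subset[OF starred_subset finite_V] .
    have "card (starred V ?q2) = card (starred V p)"
      unfolding S2 using card.remove[OF fin wS(2)] fin vS by simp
    then have le: "card (\<Union> (split_edges E ?q2)) \<le> card (\<Union> (split_edges E p))"
      using opt q2 unfolding optimal_def by blast
    \<comment> \<open>Only \<open>w\<close> loses its centre in the exchange, so edges split by
      another leaf stay split.\<close>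
    have keep: "g \<in> split_edges E ?q2" if g: "g \<in> E" "z \<in> g" "p z \<noteq> z" "p z \<in> g" "z \<noteq> w" for g z
    proof -
      have "z \<noteq> v" using g(3) pv by metis
      then have "?q2 z = p z" using g(5) by simp
      then show ?thesis using g split_edgesI[of g E z ?q2] by simp
    qed
    \<comment> \<open>If \<open>g\<close> was split only through \<open>w\<close>, its vertices are
      starred by \<open>st\<close>; they remain starred and thus covered, except \<open>p w\<close>,
      which \<open>f\<close> covers because \<open>y\<close> still splits \<open>f\<close>.\<close>
    have "x \<in> \<Union> (split_edges E ?q2)" if "x \<in> \<Union> (split_edges E p)" for x
    proof -
      obtain g z where g: "g \<in> E" "z \<in> g" "p z \<noteq> z" "p z \<in> g" "x \<in> g" using \<open>x \<in> _\<close> by (auto simp: split_edges_def)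
      show ?thesis
      proof (cases "z = w")
        case True
        then have "x \<in> starred V p" using st[OF g(5,1)] g(2,4) by simp
        show ?thesis
        proof (cases "x = p w")
          case True
          then show ?thesis using UnionI[OF keep[OF f(1) y yw], of x] f(3) by simp
        next
          case False
          then have "x \<in> starred V ?q2" using S2 \<open>x \<in> starred V p\<close> by simp
          then show ?thesis using starred_subset_covered[OF q2] by (rule subsetD[rotated])
        qed
      next
        case False
        then show ?thesis using UnionI[OF keep[OF g(1-4)] g(5)] by simp
      qed
    qed
    moreover have "v \<in> starred V ?q2" using S2 by simp
    then have "v \<in> \<Union> (split_edges E ?q2)" using starred_subset_covered[OF q2] by (rule subsetD[rotated])
    ultimately have "insert v (\<Union> (split_edges E p)) \<subseteq> \<Union> (split_edges E ?q2)"
      by (intro insert_subsetI subsetI)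
    moreover have "finite (\<Union> (split_edges E ?q2))"
      using finite_E finite_edge by (auto simp: split_edges_def)
    ultimately have "card (insert v (\<Union> (split_edges E p))) \<le> card (\<Union> (split_edges E ?q2))"
      using card_mono by blast
    moreover have "finite (\<Union> (split_edges E p))"
      using finite_E finite_edge by (auto simp: split_edges_def)
    ultimately show False using le v by auto
  qed
qed

text \<open>Each uncovered \<open>v\<close> is charged to an edge \<open>f v\<close> through an
  adjacent star \<open>w v\<close>, \<open>p (w v)\<close>. A charged edge has to account only for
  these three vertices, an uncharged split edge for its \<open>k\<close> vertices. The maximum
  differs from \<open>k\<close> only for \<open>k = 2\<close>.\<close>

lemma card_V_le: "card V \<le> max k 3 * card (split_edges E p)"
proof -
  define U where "U = V - \<Union> (split_edges E p)"
  have "\<exists>w f. w \<in> V \<and> p w \<noteq> w \<and> adj E v w \<and> f \<in> E \<and> w \<in> f \<and> p w \<in> f" if "v \<in> U" for v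
  proof -
    have "v \<in> V" "v \<notin> starred V p" using starred_subset_covered[OF packing] that U_def by auto
    then obtain w where w: "w \<in> V" "p w \<noteq> w" "adj E v w" using ex_triangle by blast
    then have "adj E w (p w)" using packing by (auto simp: star_packing_def)
    then show ?thesis using w by (auto simp: adj_def)
  qed
  then obtain w f where wf: "\<And>v. v \<in> U \<Longrightarrow>
      w v \<in> V \<and> p (w v) \<noteq> w v \<and> adj E v (w v) \<and> f v \<in> E \<and> w v \<in> f v \<and> p (w v) \<in> f v"
    by metis
  have US: "v \<in> V" "v \<notin> \<Union> (split_edges E p)" "v \<notin> starred V p" if "v \<in> U" for v
    using starred_subset_covered[OF packing] that U_def by auto
  have fT: "f ` U \<subseteq> split_edges E p" using wf by (auto intro: split_edgesI)
  have only: "y = w v" if "v \<in> U" "y \<in> f v" "p y \<noteq> y" "p y \<in> f v" for v y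
    using triangle_edge(2)[of v "w v" "f v" y] wf US that by blast
  \<comment> \<open>The edge determines its only leaf with centre inside, and this star determines
    the unstarred vertex adjacent to it.\<close>
  have inj: "inj_on f U"
  proof
    fix v x assume vx: "v \<in> U" "x \<in> U" "f v = f x"
    then have "w x = w v" using only[of v "w x"] wf by metis
    then have "adj E x (p (w v))" using single_triangle(2)[of x "w x"] vx wf US by metis
    then show "v = x" using single_unique[of v "w v" x] vx wf US by metis
  qed
  have fin: "finite U" "finite (split_edges E p)" 
    using finite_V finite_E by (auto simp: U_def split_edges_def)
  \<comment> \<open>A leaf-centre pair inside a charged edge \<open>f v\<close> is the pair
    \<open>w v\<close>, \<open>p (w v)\<close>. An unstarred vertex of a split edge is in no charged
    edge, as charged edges consist of starred vertices.\<close>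
  have "V \<subseteq> \<Union> (split_edges E p - f ` U) \<union> (\<Union>v\<in>U. {v, w v, p (w v)})"
  proof
    fix x assume x: "x \<in> V"
    consider "x \<in> U" | "x \<in> starred V p" | e where "x \<notin> starred V p" "e \<in> split_edges E p" "x \<in> e"
      using x by (auto simp: U_def)
    then show "x \<in> \<Union> (split_edges E p - f ` U) \<union> (\<Union>v\<in>U. {v, w v, p (w v)})"
    proof cases
      case 2
      obtain u e where u: "u \<in> V" "p u \<noteq> u" "x = u \<or> x = p u" "e \<in> E" "u \<in> e" "p u \<in> e"
        using starred_split_edge[OF packing 2] by blast
      then have e: "e \<in> split_edges E p" by (auto intro: split_edgesI)
      show ?thesis
      proof (cases "e \<in> f ` U")
        case True
        then show ?thesis using only u by blast
      next
        case False
        then show ?thesis using e u by blast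
      qed
    next
      case 3
      have "e \<notin> f ` U" using triangle_edge(1)[of _ "w _" "f _" x] wf US 3 by blast
      then show ?thesis using 3 by auto
    qed auto
  qed
  then have "card V \<le> card (\<Union> (split_edges E p - f ` U) \<union> (\<Union>v\<in>U. {v, w v, p (w v)}))"
    using fin finite_edge by (intro card_mono) (auto simp: split_edges_def)
  also have "\<dots> \<le> card (\<Union> (split_edges E p - f ` U)) + card (\<Union>v\<in>U. {v, w v, p (w v)})"
    by (rule card_Un_le)
  also have "card (\<Union> (split_edges E p - f ` U)) \<le> (\<Sum>e\<in>split_edges E p - f ` U. card e)"
    by (rule card_Union_le_sum_card)
  also have "\<dots> \<le> max k 3 * card (split_edges E p - f ` U)"
    using card_edge by (subst mult.commute, intro sum_bounded_above[where 'a = nat, simplified])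
      (auto simp: split_edges_def)
  also have "card (\<Union>v\<in>U. {v, w v, p (w v)}) \<le> (\<Sum>v\<in>U. card {v, w v, p (w v)})"
    using fin by (intro card_UN_le)
  also have "\<dots> \<le> (\<Sum>v\<in>U. max k 3)"
    by (intro sum_mono max.coboundedI2) (auto intro: order.trans[OF card_insert_le_m1] simp: card_insert_if)
  also have "\<dots> = max k 3 * card (f ` U)" using inj by (simp add: card_image)
  finally have "card V \<le> max k 3 * (card (split_edges E p - f ` U) + card (f ` U))"
    by (simp add: algebra_simps)
  also have "card (split_edges E p - f ` U) + card (f ` U) = card (split_edges E p)"
    using fT fin by (metis card_Diff_subset card_mono finite_imageI le_add_diff_inverse2)
  finally show ?thesis .
qed

end

lemma ex_star_packing:
  obtains p where "star_packing V E p" "card V \<le> max k 3 * card (split_edges E p)"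
  using ex_optimal card_V_le packing by blast

end

subsection \<open>Counting colourings\<close>

text \<open>Induction along the Stirling recurrence: once the value \<open>b\<close> at
  \<open>a\<close> is removed, the rest of the surjection is onto \<open>B\<close> or onto
  \<open>B - {b}\<close>.\<close>

lemma card_surjections:
  assumes "finite A" "finite B"
  shows "card {f \<in> A \<rightarrow>\<^sub>E B. f ` A = B} = fact (card B) * Stirling (card A) (card B)"
  using assms
proof (induction A arbitrary: B rule: finite_induct)
  case empty
  show ?case
  proof (cases "B = {}")
    case False
    then have "{f \<in> {} \<rightarrow>\<^sub>E B. f ` {} = B} = {}" by auto
    then show ?thesis using False empty by (simp add: card_gt_0_iff)
  qed auto
next
  case (insert a A)
  define S where "S C = {f \<in> A \<rightarrow>\<^sub>E C. f ` A = C}" for C :: "'b set"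
  have finS: "finite (S C)" if "finite C" for C
    unfolding S_def using that insert.hyps
    by (intro finite_subset[OF _ finite_PiE[of A "\<lambda>_. C"]]) auto
  have S_I: "g \<in> extensional A \<Longrightarrow> g ` A = C \<Longrightarrow> g \<in> S C" for g C
    by (auto simp: S_def PiE_def)
  have disj: "S B \<inter> S (B - {b}) = {}" if "b \<in> B" for b using that by (auto simp: S_def)
  let ?F = "\<lambda>(b, f). f(a := b)"
  have "bij_betw ?F (SIGMA b:B. S B \<union> S (B - {b})) {f \<in> insert a A \<rightarrow>\<^sub>E B. f ` insert a A = B}"
  proof (rule bij_betw_byWitness[where f' = "\<lambda>f. (f a, f(a := undefined))"])
    show "\<forall>x\<in>SIGMA b:B. S B \<union> S (B - {b}). (?F x a, (?F x)(a := undefined)) = x"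
      using insert.hyps by (auto simp: S_def fun_eq_iff PiE_def extensional_def)
    show "\<forall>f\<in>{f \<in> insert a A \<rightarrow>\<^sub>E B. f ` insert a A = B}. ?F (f a, f(a := undefined)) = f"
      by auto
    show "?F ` (SIGMA b:B. S B \<union> S (B - {b})) \<subseteq> {f \<in> insert a A \<rightarrow>\<^sub>E B. f ` insert a A = B}"
    proof (rule image_subsetI)
      fix z assume "z \<in> (SIGMA b:B. S B \<union> S (B - {b}))"
      then obtain b f where z: "z = (b, f)" and b: "b \<in> B" and f: "f \<in> S B \<or> f \<in> S (B - {b})" by auto
      have "f \<in> A \<rightarrow>\<^sub>E B" using f by (auto simp: S_def PiE_def)
      then have "f(a := b) \<in> insert a A \<rightarrow>\<^sub>E B" using b by (auto simp: PiE_def extensional_def)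
      moreover have "f(a := b) ` A = f ` A" using insert.hyps by (intro image_cong) auto
      then have "f(a := b) ` insert a A = B" using b f by (auto simp: S_def)
      ultimately have "f(a := b) \<in> {f \<in> insert a A \<rightarrow>\<^sub>E B. f ` insert a A = B}" by blast
      then show "?F z \<in> {f \<in> insert a A \<rightarrow>\<^sub>E B. f ` insert a A = B}" unfolding z prod.case .
    qed
    show "(\<lambda>f. (f a, f(a := undefined))) ` {f \<in> insert a A \<rightarrow>\<^sub>E B. f ` insert a A = B}
      \<subseteq> (SIGMA b:B. S B \<union> S (B - {b}))"
    proof (rule image_subsetI)
      fix f assume "f \<in> {f \<in> insert a A \<rightarrow>\<^sub>E B. f ` insert a A = B}"
      then have f: "f \<in> insert a A \<rightarrow>\<^sub>E B" "insert (f a) (f ` A) = B" by auto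
      let ?g = "f(a := undefined)"
      have im: "?g ` A = f ` A" using insert.hyps by (intro image_cong) auto
      have "?g \<in> extensional A" using f(1) by (auto simp: PiE_def extensional_def)
      moreover have "f ` A = B \<or> f ` A = B - {f a}" using f(2) by blast
      ultimately have "?g \<in> S B \<union> S (B - {f a})" using S_I[of ?g] unfolding im by blast
      then show "(f a, ?g) \<in> (SIGMA b:B. S B \<union> S (B - {b}))" using f(2) by auto
    qed
  qed
  then have "card {f \<in> insert a A \<rightarrow>\<^sub>E B. f ` insert a A = B} = card (SIGMA b:B. S B \<union> S (B - {b}))"
    by (rule bij_betw_same_card[symmetric])
  also have "\<dots> = (\<Sum>b\<in>B. card (S B) + card (S (B - {b})))"
    using insert.prems finS disj by (subst card_SigmaI) (auto intro!: sum.cong card_Un_disjoint)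
  \<comment> \<open>The truncated \<open>card B - 1\<close> is harmless: for empty \<open>B\<close>
    the sum has no terms.\<close>
  also have "\<dots> = (\<Sum>b\<in>B. fact (card B) * Stirling (card A) (card B)
      + fact (card B - 1) * Stirling (card A) (card B - 1))"
    using insert.IH insert.prems by (intro sum.cong) (auto simp: S_def)
  also have "\<dots> = fact (card B) * Stirling (card (insert a A)) (card B)"
    using insert.hyps by (cases "card B") (auto simp: algebra_simps)
  finally show ?case .
qed

text \<open>The values outside \<open>A\<close> are free: a function on \<open>V\<close> is glued
  from one on \<open>A\<close> and one on \<open>V - A\<close>.\<close>

lemma card_PiE_restrict:
  assumes "finite V" "A \<subseteq> V" "Q \<subseteq> A \<rightarrow>\<^sub>E C"
  shows "card {f \<in> V \<rightarrow>\<^sub>E C. restrict f A \<in> Q} = card Q * card C ^ (card V - card A)"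
proof -
  let ?m = "\<lambda>(g, h). \<lambda>v. if v \<in> A then g v else h v"
  have m: "restrict (?m (g, h)) A = g" "restrict (?m (g, h)) (V - A) = h" "?m (g, h) \<in> V \<rightarrow>\<^sub>E C"
    if "g \<in> A \<rightarrow>\<^sub>E C" "h \<in> (V - A) \<rightarrow>\<^sub>E C" for g h
  proof -
    have ex: "\<And>v. v \<notin> A \<Longrightarrow> g v = undefined" "\<And>v. v \<notin> V - A \<Longrightarrow> h v = undefined"
      using that by (blast intro: PiE_arb)+
    show "restrict (?m (g, h)) A = g" "restrict (?m (g, h)) (V - A) = h"
      by (intro ext; use ex in \<open>simp add: restrict_def\<close>)+
    show "?m (g, h) \<in> V \<rightarrow>\<^sub>E C"
    proof (rule PiE_I)
      fix v assume "v \<in> V"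
      then show "?m (g, h) v \<in> C" using \<open>g \<in> _\<close> \<open>h \<in> _\<close> by (cases "v \<in> A") auto
    next
      fix v assume "v \<notin> V"
      then show "?m (g, h) v = undefined" using ex(2) assms(2) by auto
    qed
  qed
  have r: "?m (restrict f A, restrict f (V - A)) = f" if "f \<in> V \<rightarrow>\<^sub>E C" for f
    using that assms(2) by (auto simp: fun_eq_iff PiE_def extensional_def)
  have "bij_betw ?m (Q \<times> ((V - A) \<rightarrow>\<^sub>E C)) {f \<in> V \<rightarrow>\<^sub>E C. restrict f A \<in> Q}"
  proof (rule bij_betw_byWitness[where f' = "\<lambda>f. (restrict f A, restrict f (V - A))"])
    show "\<forall>x\<in>Q \<times> ((V - A) \<rightarrow>\<^sub>E C). (restrict (?m x) A, restrict (?m x) (V - A)) = x"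
    proof
      fix x assume "x \<in> Q \<times> ((V - A) \<rightarrow>\<^sub>E C)"
      then obtain g h where "x = (g, h)" "g \<in> A \<rightarrow>\<^sub>E C" "h \<in> (V - A) \<rightarrow>\<^sub>E C" using assms(3) by auto
      then show "(restrict (?m x) A, restrict (?m x) (V - A)) = x" using m[of g h] by simp
    qed
    show "\<forall>f\<in>{f \<in> V \<rightarrow>\<^sub>E C. restrict f A \<in> Q}. ?m (restrict f A, restrict f (V - A)) = f"
      using r by blast
    show "?m ` (Q \<times> ((V - A) \<rightarrow>\<^sub>E C)) \<subseteq> {f \<in> V \<rightarrow>\<^sub>E C. restrict f A \<in> Q}"
    proof (rule image_subsetI)
      fix x assume "x \<in> Q \<times> ((V - A) \<rightarrow>\<^sub>E C)"
      then obtain g h where x: "x = (g, h)" "g \<in> Q" "h \<in> (V - A) \<rightarrow>\<^sub>E C" by auto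
      then have "g \<in> A \<rightarrow>\<^sub>E C" using assms(3) by auto
      then show "?m x \<in> {f \<in> V \<rightarrow>\<^sub>E C. restrict f A \<in> Q}" using m(1,3)[of g h] x by simp
    qed
    show "(\<lambda>f. (restrict f A, restrict f (V - A))) ` {f \<in> V \<rightarrow>\<^sub>E C. restrict f A \<in> Q}
        \<subseteq> Q \<times> ((V - A) \<rightarrow>\<^sub>E C)"
      by auto
  qed
  then have "card {f \<in> V \<rightarrow>\<^sub>E C. restrict f A \<in> Q} = card (Q \<times> ((V - A) \<rightarrow>\<^sub>E C))"
    by (rule bij_betw_same_card[symmetric])
  then show ?thesis using assms(1,2)
    by (simp add: card_cartesian_product card_funcsetE card_Diff_subset finite_subset)
qed

section \<open>Colourings under inequality constraints\<close>

definition colourings :: "'a set \<Rightarrow> nat \<Rightarrow> ('a \<times> 'a) set \<Rightarrow> ('a \<Rightarrow> nat) set" where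
  "colourings V r D = {x \<in> V \<rightarrow>\<^sub>E {..<r}. \<forall>(a, b)\<in>D. x a \<noteq> x b}"

lemma finite_colourings: "finite V \<Longrightarrow> finite (colourings V r D)"
  unfolding colourings_def by (rule finite_subset[OF _ finite_PiE[of V "\<lambda>_. {..<r}"]]) auto

text \<open>Recolouring \<open>a\<close> arbitrarily maps the colourings in \<open>P\<close> with \<open>x a = x b\<close>, times \<open>r\<close>, bijectively
  to the colourings that stay in \<open>P\<close> when \<open>a\<close> receives the colour of \<open>b\<close>.\<close>

lemma card_colourings_insert:
  assumes V: "finite V" "a \<in> V" "b \<in> V" "a \<noteq> b" and r: "0 < r"
    and fresh: "\<And>c d. (c, d) \<in> D \<Longrightarrow> a \<noteq> c \<and> a \<noteq> d"
    and stable: "\<And>x c. x \<in> V \<rightarrow>\<^sub>E {..<r} \<Longrightarrow> x a = x b \<Longrightarrow> P x \<Longrightarrow> c < r \<Longrightarrow> P (x(a := c))"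
  shows "r * card {x \<in> colourings V r (insert (a, b) D). P x} =
    (r - 1) * card {x \<in> colourings V r D. P x} + card {x \<in> colourings V r D. P x \<and> \<not> P (x(a := x b))}"
proof -
  let ?N = "{x \<in> colourings V r D. P x}" and ?A = "{x \<in> colourings V r (insert (a, b) D). P x}"
  let ?B = "{x \<in> colourings V r D. P x \<and> x a = x b}" and ?G = "{x \<in> colourings V r D. P (x(a := x b))}"
  let ?Z = "{x \<in> colourings V r D. P x \<and> \<not> P (x(a := x b))}"
  note fin = finite_colourings[OF V(1), of r D]
  have upd: "x(a := c) \<in> colourings V r D" if x: "x \<in> colourings V r D" and c: "c < r" for x c
  proof -
    have "x(a := c) \<in> V \<rightarrow>\<^sub>E {..<r}" using x c V(2) by (auto simp: colourings_def PiE_def extensional_def)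
    moreover have "(x(a := c)) u \<noteq> (x(a := c)) v" if "(u, v) \<in> D" for u v
      using x fresh[OF that] that by (auto simp: colourings_def)
    ultimately show ?thesis unfolding colourings_def by blast
  qed
  have col: "x v < r" if "x \<in> colourings V r D" "v \<in> V" for x v
    using that by (auto simp: colourings_def)
  have PiE: "x \<in> V \<rightarrow>\<^sub>E {..<r}" if "x \<in> colourings V r D" for x
    using that by (auto simp: colourings_def)
  have "bij_betw (\<lambda>(x, c). x(a := c)) (?B \<times> {..<r}) ?G"
  proof (rule bij_betw_byWitness[where f' = "\<lambda>y. (y(a := y b), y a)"])
    show "\<forall>y\<in>?B \<times> {..<r}. (((\<lambda>(x, c). x(a := c)) y)(a := (\<lambda>(x, c). x(a := c)) y b), (\<lambda>(x, c). x(a := c)) y a) = y"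
      using V(4) by (auto simp: fun_upd_idem)
    show "\<forall>y\<in>?G. (\<lambda>(x, c). x(a := c)) (y(a := y b), y a) = y" by simp
    show "(\<lambda>(x, c). x(a := c)) ` (?B \<times> {..<r}) \<subseteq> ?G"
    proof (rule image_subsetI)
      fix z assume "z \<in> ?B \<times> {..<r}"
      then obtain x c where z: "z = (x, c)" and x: "x \<in> colourings V r D" "P x" "x a = x b" and c: "c < r"
        by auto
      have "x(a := x b) = x" using x(3) by (simp add: fun_upd_idem)
      then have "(x(a := c))(a := (x(a := c)) b) = x" using V(4) by simp
      then show "(\<lambda>(x, c). x(a := c)) z \<in> ?G"
        using upd[OF x(1) c] x(2) unfolding z prod.case mem_Collect_eq by simp
    qed
    show "(\<lambda>y. (y(a := y b), y a)) ` ?G \<subseteq> ?B \<times> {..<r}"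
    proof (rule image_subsetI)
      fix y assume "y \<in> ?G"
      then show "(y(a := y b), y a) \<in> ?B \<times> {..<r}"
        using upd[of y "y b"] col[of y b] col[of y a] V by simp
    qed
  qed
  then have "card ?G = r * card ?B"
    by (simp add: bij_betw_same_card[symmetric] card_cartesian_product)
  \<comment> \<open>If \<open>P\<close> holds once \<open>a\<close> has the colour of
    \<open>b\<close>, stability allows \<open>a\<close> to be given back its own colour.\<close>
  moreover have "?G \<subseteq> ?N"
  proof clarify
    fix x assume x: "x \<in> colourings V r D" "P (x(a := x b))"
    show "P x"
      using stable[of "x(a := x b)" "x a"] PiE[OF upd[OF x(1) col[OF x(1) V(3)]]] x V(4) col[OF x(1) V(2)]
      by simp
  qed
  then have "?N = ?G \<union> ?Z" by auto
  then have "card ?N = card ?G + card ?Z"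
    using fin by (simp only:) (subst card_Un_disjoint; auto)
  moreover have "card ?N = card ?A + card ?B"
  proof -
    have "?N = ?A \<union> ?B" "?A \<inter> ?B = {}" by (auto simp: colourings_def)
    then show ?thesis using finite_colourings[OF V(1)] by (simp add: card_Un_disjoint)
  qed
  \<comment> \<open>Here \<open>r * A = r * N - r * B = r * N - G\<close> and
    \<open>G = N - Z\<close>; adding \<open>N\<close> to both sides avoids subtraction of
    naturals.\<close>
  moreover have "r * A = (r - 1) * N + Z" if "G = r * B" "N = G + Z" "N = A + B" for A B G N Z :: nat
  proof -
    have "r * A + N = r * A + r * B + Z" using that(1,2) by simp
    also have "\<dots> = r * N + Z" unfolding that(3) by (simp add: distrib_left)
    finally show ?thesis using r by (cases r) auto
  qed
  ultimately show ?thesis by blast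
qed

text \<open>Add the constraints one by one with \<open>card_colourings_insert\<close>. Dropping its
  last term, each constraint keeps at least the fraction (r-1)/r of the colourings with
  \<open>P\<close>; if \<open>P\<close> always holds the term is zero and the fraction exact. The
  map \<open>\<alpha>\<close> selects the end to be recoloured, which may be a leaf or a
  centre.\<close>

lemma card_colourings_Un:
  fixes \<alpha> \<beta> :: "'b \<Rightarrow> 'a"
  assumes V: "finite V" "\<alpha> ` L \<subseteq> V" "\<beta> ` L \<subseteq> V" and L: "finite L" and r: "0 < r"
    and fresh: "inj_on \<alpha> L" "\<And>u v. u \<in> L \<Longrightarrow> v \<in> L \<Longrightarrow> \<alpha> u \<noteq> \<beta> v"
      "\<And>v c d. v \<in> L \<Longrightarrow> (c, d) \<in> D \<Longrightarrow> \<alpha> v \<noteq> c \<and> \<alpha> v \<noteq> d"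
    and stable: "\<And>v x c. v \<in> L \<Longrightarrow> x \<in> V \<rightarrow>\<^sub>E {..<r} \<Longrightarrow> x (\<alpha> v) = x (\<beta> v) \<Longrightarrow> P x \<Longrightarrow> c < r \<Longrightarrow>
      P (x(\<alpha> v := c))"
  shows "(r - 1) ^ card L * card {x \<in> colourings V r D. P x} \<le>
      r ^ card L * card {x \<in> colourings V r (D \<union> (\<lambda>v. (\<alpha> v, \<beta> v)) ` L). P x}" (is ?le)
    and "(\<And>x. P x) \<Longrightarrow> (r - 1) ^ card L * card {x \<in> colourings V r D. P x} =
      r ^ card L * card {x \<in> colourings V r (D \<union> (\<lambda>v. (\<alpha> v, \<beta> v)) ` L). P x}"
proof -
  let ?n = "\<lambda>D. card {x \<in> colourings V r D. P x}"
  have "?le \<and> ((\<forall>x. P x) \<longrightarrow> (r - 1) ^ card L * ?n D = r ^ card L * ?n (D \<union> (\<lambda>v. (\<alpha> v, \<beta> v)) ` L))"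
    using L V(2,3) fresh stable
  proof (induction L rule: finite_induct)
    case (insert v L)
    let ?D = "D \<union> (\<lambda>v. (\<alpha> v, \<beta> v)) ` L"
    have "(r - 1) ^ card L * ?n D \<le> r ^ card L * ?n ?D \<and>
      ((\<forall>x. P x) \<longrightarrow> (r - 1) ^ card L * ?n D = r ^ card L * ?n ?D)"
    proof (rule insert.IH)
      show "P (x(\<alpha> u := c))"
        if "u \<in> L" "x \<in> V \<rightarrow>\<^sub>E {..<r}" "x (\<alpha> u) = x (\<beta> u)" "P x" "c < r" for u x c
        using insert.prems(6)[of u x c] that by blast
      show "\<alpha> v \<noteq> c \<and> \<alpha> v \<noteq> d" if "v \<in> L" "(c, d) \<in> D" for v c d
        using insert.prems(5)[of v c d] that by blast
    qed (use insert.prems(1-4) in auto)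
    then have IH: "(r - 1) ^ card L * ?n D \<le> r ^ card L * ?n ?D"
      "(\<forall>x. P x) \<longrightarrow> (r - 1) ^ card L * ?n D = r ^ card L * ?n ?D" by (rule conjunct1, rule conjunct2)
    have eq: "r * ?n (insert (\<alpha> v, \<beta> v) ?D) = (r - 1) * ?n ?D
        + card {x \<in> colourings V r ?D. P x \<and> \<not> P (x(\<alpha> v := x (\<beta> v)))}"
    proof (rule card_colourings_insert[OF V(1)])
      show "\<alpha> v \<noteq> c \<and> \<alpha> v \<noteq> d" if cd: "(c, d) \<in> ?D" for c d
      proof (cases "(c, d) \<in> D")
        case True
        then show ?thesis using insert.prems(5)[of v c d] by blast
      next
        case False
        then obtain u where u: "u \<in> L" "c = \<alpha> u" "d = \<beta> u" using cd by auto
        then have "\<alpha> v \<noteq> \<alpha> u" using insert.prems(3) insert.hyps(2) by (auto simp: inj_on_def)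
        then show ?thesis using u insert.prems(4)[of v u] by blast
      qed
      show "\<alpha> v \<noteq> \<beta> v" using insert.prems(4)[of v v] by blast
      show "P (x(\<alpha> v := c))"
        if "x \<in> V \<rightarrow>\<^sub>E {..<r}" "x (\<alpha> v) = x (\<beta> v)" "P x" "c < r" for x c
        using insert.prems(6)[of v x c] that by blast
    qed (use insert.prems(1,2) r in auto)
    have step: "(r - 1) * ?n ?D \<le> r * ?n (insert (\<alpha> v, \<beta> v) ?D)" unfolding eq by simp
    have step_eq: "(r - 1) * ?n ?D = r * ?n (insert (\<alpha> v, \<beta> v) ?D)" if "\<forall>x. P x"
      unfolding eq using that by simp
    have ins: "D \<union> (\<lambda>v. (\<alpha> v, \<beta> v)) ` insert v L = insert (\<alpha> v, \<beta> v) ?D" by auto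
    have "(r - 1) ^ card (insert v L) * ?n D = (r - 1) * ((r - 1) ^ card L * ?n D)"
      using insert.hyps by simp
    also have "\<dots> \<le> (r - 1) * (r ^ card L * ?n ?D)" using IH(1) by (rule mult_left_mono) simp
    also have "\<dots> = r ^ card L * ((r - 1) * ?n ?D)" by simp
    also have "\<dots> \<le> r ^ card L * (r * ?n (insert (\<alpha> v, \<beta> v) ?D))"
      using step by (rule mult_left_mono) simp
    finally have le: "(r - 1) ^ card (insert v L) * ?n D \<le>
        r ^ card (insert v L) * ?n (insert (\<alpha> v, \<beta> v) ?D)"
      using insert.hyps by (simp add: mult_ac)
    have "(r - 1) ^ card (insert v L) * ?n D = r ^ card (insert v L) * ?n (insert (\<alpha> v, \<beta> v) ?D)"
      if "\<forall>x. P x"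
    proof -
      have "(r - 1) ^ card (insert v L) * ?n D = (r - 1) * ((r - 1) ^ card L * ?n D)"
        using insert.hyps by simp
      also have "\<dots> = r ^ card L * ((r - 1) * ?n ?D)" using IH(2) that by simp
      also have "\<dots> = r ^ card L * (r * ?n (insert (\<alpha> v, \<beta> v) ?D))" unfolding step_eq[OF that] ..
      finally show ?thesis using insert.hyps by (simp add: mult_ac)
    qed
    then show ?case using le ins by auto
  qed simp
  then show ?le "(\<And>x. P x) \<Longrightarrow> (r - 1) ^ card L * ?n D = r ^ card L * ?n (D \<union> (\<lambda>v. (\<alpha> v, \<beta> v)) ` L)"
    by auto
qed

section \<open>Colourings showing all colours on one edge\<close>

lemma ex_surjection:
  assumes "finite A" "finite B" "B \<noteq> {}" "card B \<le> card A"
  obtains g where "g ` A = B"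
  using assms inj_on_iff_card_le inj_on_iff_surj by metis

text \<open>Divided by \<open>r ^ card V\<close>, this is the probability subtracted in
  \<open>excess\<close>, for \<open>card e = k\<close>.\<close>

lemma card_rainbow:
  assumes "finite V" "e \<subseteq> V"
  shows "card {x \<in> colourings V r {}. {..<r} \<subseteq> x ` e} =
    fact r * Stirling (card e) r * r ^ (card V - card e)"
proof -
  have "{x \<in> colourings V r {}. {..<r} \<subseteq> x ` e} =
      {x \<in> V \<rightarrow>\<^sub>E {..<r}. restrict x e \<in> {f \<in> e \<rightarrow>\<^sub>E {..<r}. f ` e = {..<r}}}"
    using assms(2) by (auto simp: colourings_def subset_iff)
  then show ?thesis
    using card_PiE_restrict[OF assms, of "{f \<in> e \<rightarrow>\<^sub>E {..<r}. f ` e = {..<r}}" "{..<r}"]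
      card_surjections[of e "{..<r}"] finite_subset[OF assms(2,1)] by auto
qed

text \<open>For each colour \<open>c\<close> there is a colouring of \<open>e\<close> in which
  \<open>c\<close> occurs only at \<open>a\<close>: the other vertices, at least
  \<open>r - 1\<close> in number, are mapped onto the other colours. Recolouring \<open>a\<close>
  then loses \<open>c\<close>.\<close>

lemma card_rainbow_lost:
  assumes "finite V" "e \<subseteq> V" "a \<in> e" "b \<in> e" "a \<noteq> b" "2 \<le> r" "r \<le> card e"
  shows "r * r ^ (card V - card e) \<le>
    card {x \<in> colourings V r {}. {..<r} \<subseteq> x ` e \<and> \<not> {..<r} \<subseteq> (x(a := x b)) ` e}"
proof -
  let ?Q = "{f \<in> e \<rightarrow>\<^sub>E {..<r}. f ` e = {..<r} \<and> \<not> {..<r} \<subseteq> f ` (e - {a})}"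
  have fin: "finite e" using assms finite_subset by auto
  have "\<exists>f. f \<in> ?Q \<and> f a = c" if c: "c < r" for c
  proof -
    have "card ({..<r} - {c}) \<le> card (e - {a})"
      using c assms(3,7) fin by simp
    moreover have "{..<r} - {c} \<noteq> {}"
    proof -
      have "card ({..<r} - {c}) > 0" using c assms(6) by simp
      then show ?thesis by (metis card.empty less_irrefl)
    qed
    ultimately obtain g where g: "g ` (e - {a}) = {..<r} - {c}"
      using ex_surjection[of "e - {a}" "{..<r} - {c}"] fin finite_Diff finite_lessThan by metis
    define f where "f = restrict (g(a := c)) e"
    have 1: "f ` (e - {a}) = {..<r} - {c}" using g by (auto simp: f_def image_iff) 
    have 2: "f a = c" using assms(3) by (simp add: f_def)
    have 3: "f ` e = insert (f a) (f ` (e - {a}))" using assms(3) by auto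
    have "f ` e = {..<r}" using 1 2 3 c by auto
    moreover have "f \<in> extensional e" by (simp add: f_def)
    ultimately have "f \<in> e \<rightarrow>\<^sub>E {..<r}" "f ` e = {..<r}" unfolding PiE_def by blast+
    moreover have "\<not> {..<r} \<subseteq> f ` (e - {a})" using 1 c by auto
    ultimately show ?thesis using 2 by blast
  qed
  \<comment> \<open>The colour at \<open>a\<close> tells the colourings for different
    \<open>c\<close> apart, so there are at least \<open>r\<close> of them.\<close>
  then have "{..<r} \<subseteq> (\<lambda>f. f a) ` ?Q" by blast
  moreover have "finite ?Q" 
    by (rule finite_subset[OF _ finite_PiE[of e "\<lambda>_. {..<r}"]]) (use fin in auto)
  ultimately have "r \<le> card ?Q" using surj_card_le by fastforce
  moreover have "{x \<in> colourings V r {}. {..<r} \<subseteq> x ` e \<and> \<not> {..<r} \<subseteq> (x(a := x b)) ` e} =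
      {x \<in> V \<rightarrow>\<^sub>E {..<r}. restrict x e \<in> ?Q}"
  proof -
    \<comment> \<open>The new colour of \<open>a\<close> is already present at \<open>b\<close> in
      \<open>e - {a}\<close>.\<close>
    have "(x(a := x b)) ` e = restrict x e ` (e - {a})" for x :: "'a \<Rightarrow> nat"
      using assms(3-5) by (auto simp: image_iff)
    then show ?thesis using assms(2) by (auto simp: colourings_def subset_iff)
  qed
  ultimately show ?thesis
    using card_PiE_restrict[OF assms(1,2), of ?Q "{..<r}"] by auto
qed

subsection \<open>Cuts from star packings\<close>

context hypergraph
begin

context
  fixes p :: "'a \<Rightarrow> 'a" and r :: nat
  assumes packing: "star_packing V E p" and r: "2 \<le> r" "r \<le> k"
begin

private definition "leaves = {v \<in> V. p v \<noteq> v}"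

private abbreviation "links \<equiv> (\<lambda>v. (v, p v)) ` leaves"

private abbreviation "rainbow D e \<equiv> {x \<in> colourings V r D. {..<r} \<subseteq> x ` e}"

lemma leaf: "v \<in> leaves \<Longrightarrow> v \<in> V" "v \<in> leaves \<Longrightarrow> p v \<in> V" "v \<in> leaves \<Longrightarrow> p v \<notin> leaves"
  using packing by (auto simp: leaves_def star_packing_def)

lemma finite_leaves: "finite leaves"
  using finite_V by (simp add: leaves_def)

text \<open>The exact case of \<open>card_colourings_Un\<close>: each leaf keeps the fraction
  (r-1)/r of all colourings.\<close>

lemma card_colourings_links:
  "r ^ card leaves * card (colourings V r links) = (r - 1) ^ card leaves * r ^ card V"
proof -
  have "(r - 1) ^ card leaves * card {x \<in> colourings V r {}. True} =
      r ^ card leaves * card {x \<in> colourings V r ({} \<union> links). True}"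
  proof (rule card_colourings_Un(2)[OF finite_V])
    show "u \<noteq> p v" if "u \<in> leaves" "v \<in> leaves" for u v using leaf(3)[OF that(2)] that(1) by blast
  qed (use leaf finite_leaves r in auto)
  then show ?thesis using finite_V by (simp add: colourings_def card_funcsetE)
qed

text \<open>After normalisation: given the constraints of \<open>C0\<close>, imposing those of all
  other leaves does not lower the probability that \<open>e\<close> receives all colours. Below,
  \<open>C0\<close> is empty or a single leaf.\<close>

lemma card_rainbow_links:
  assumes e: "e \<in> E" and C0: "C0 \<subseteq> {v \<in> leaves. v \<in> e \<and> p v \<in> e}"
  shows "(r - 1) ^ card (leaves - C0) * card (rainbow ((\<lambda>v. (v, p v)) ` C0) e) \<le>
    r ^ card (leaves - C0) * card (rainbow links e)"
proof -
  define B where "B = {v \<in> leaves. v \<in> e \<and> p v \<notin> e}"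
  define C where "C = {v \<in> leaves. v \<in> e \<and> p v \<in> e} - C0"
  define A where "A = {v \<in> leaves. v \<notin> e}"
  define D0 where "D0 = (\<lambda>v. (v, p v)) ` C0"
  define D1 where "D1 = D0 \<union> (\<lambda>v. (p v, v)) ` B"
  define D2 where "D2 = D1 \<union> (\<lambda>v. (v, p v)) ` C"
  have fin: "finite A" "finite B" "finite C" using finite_leaves by (auto simp: A_def B_def C_def)
  have split: "leaves - C0 = A \<union> B \<union> C" and disj: "A \<inter> B = {}" "(A \<union> B) \<inter> C = {}"
    using C0 by (auto simp: A_def B_def C_def)
  have sub: "A \<subseteq> leaves" "B \<subseteq> leaves" "C \<subseteq> leaves" "C0 \<subseteq> leaves"
    using C0 by (auto simp: A_def B_def C_def)
  have ne: "u \<noteq> p v" if "u \<in> leaves" "v \<in> leaves" for u v using leaf(3)[OF that(2)] that(1) by blast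
  txt \<open>Adding a constraint is harmless if one of its endpoints is in no earlier constraint and, when the
    two endpoints agree, recolouring this one never destroys a rainbow on \<open>e\<close>. For a leaf in \<open>e\<close> whose centre is outside \<open>e\<close> this endpoint is the centre, so these
    constraints come before those of the other leaves of the star.\<close>
  have "inj_on p B"
  proof
    fix u v assume uv: "u \<in> B" "v \<in> B" "p u = p v"
    then have "u \<in> V" "v \<in> V" "p u \<noteq> u" "p v \<noteq> v" by (simp_all add: B_def leaves_def)
    then have "\<not> adj E u v" using packing uv(3) unfolding star_packing_def by blast
    then show "u = v" using e uv(1,2) unfolding adj_def B_def by blast
  qed
  then have 1: "(r - 1) ^ card B * card (rainbow D0 e) \<le> r ^ card B * card (rainbow D1 e)"
    unfolding D1_def
  proof (intro card_colourings_Un(1)[OF finite_V])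
    show "p ` B \<subseteq> V" "(\<lambda>v. v) ` B \<subseteq> V" using leaf sub(2) by auto
    show "p u \<noteq> v" if "u \<in> B" "v \<in> B" for u v using ne that sub(2) by blast
    show "p v \<noteq> c \<and> p v \<noteq> d" if "v \<in> B" "(c, d) \<in> D0" for v c d
      using that C0 by (auto simp: D0_def B_def)
    show "{..<r} \<subseteq> (x(p v := c)) ` e" if "v \<in> B" "{..<r} \<subseteq> x ` e" for v c and x :: "'a \<Rightarrow> nat"
    proof -
      have "(x(p v := c)) ` e = x ` e" using that(1) by (intro image_cong) (auto simp: B_def)
      then show ?thesis using that(2) by metis
    qed
  qed (use fin r in auto)
  have 2: "(r - 1) ^ card C * card (rainbow D1 e) \<le> r ^ card C * card (rainbow D2 e)"
    unfolding D2_def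
  proof (intro card_colourings_Un(1)[OF finite_V])
    show "(\<lambda>v. v) ` C \<subseteq> V" "p ` C \<subseteq> V" using leaf sub(3) by auto
    show "u \<noteq> p v" if "u \<in> C" "v \<in> C" for u v using ne that sub(3) by blast
    show "v \<noteq> c \<and> v \<noteq> d" if v: "v \<in> C" and "(c, d) \<in> D1" for v c d
    proof -
      \<comment> \<open>The ends of earlier constraints are centres and leaves outside
        \<open>C\<close>.\<close>
      have "\<exists>u\<in>leaves. u \<notin> C \<and> ((c, d) = (u, p u) \<or> (c, d) = (p u, u))"
        using that(2) sub by (auto simp: D1_def D0_def C_def B_def)
      then show ?thesis using ne v sub(3) by blast
    qed
    show "{..<r} \<subseteq> (x(v := c)) ` e" if "v \<in> C" "x v = x (p v)" "{..<r} \<subseteq> x ` e"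
      for v c and x :: "'a \<Rightarrow> nat"
    proof -
      have "p v \<in> e" "p v \<noteq> v" using that(1) by (auto simp: C_def leaves_def)
      then have "x ` e \<subseteq> (x(v := c)) ` e" using that(2) 
        by (intro image_subsetI) (metis fun_upd_other imageI)
      then show ?thesis using that(3) by blast
    qed
  qed (use fin r in auto)
  have 3: "(r - 1) ^ card A * card (rainbow D2 e) \<le>
      r ^ card A * card (rainbow (D2 \<union> (\<lambda>v. (v, p v)) ` A) e)"
  proof (intro card_colourings_Un(1)[OF finite_V])
    show "(\<lambda>v. v) ` A \<subseteq> V" "p ` A \<subseteq> V" using leaf sub(1) by auto
    show "u \<noteq> p v" if "u \<in> A" "v \<in> A" for u v using ne that sub(1) by blast
    show "v \<noteq> c \<and> v \<noteq> d" if v: "v \<in> A" and "(c, d) \<in> D2" for v c d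
    proof -
      have "\<exists>u\<in>leaves. u \<notin> A \<and> ((c, d) = (u, p u) \<or> (c, d) = (p u, u))"
        using that(2) C0 by (auto simp: D2_def D1_def D0_def C_def B_def A_def)
      then show ?thesis using ne v sub(1) by blast
    qed
    show "{..<r} \<subseteq> (x(v := c)) ` e" if "v \<in> A" "{..<r} \<subseteq> x ` e" for v c and x :: "'a \<Rightarrow> nat"
    proof -
      have "(x(v := c)) ` e = x ` e" using that(1) by (intro image_cong) (auto simp: A_def)
      then show ?thesis using that(2) by metis
    qed
  qed (use fin r in auto)
  have "leaves = C0 \<union> B \<union> C \<union> A" using split sub(4) by blast
  \<comment> \<open>The pairs from \<open>B\<close> were inserted in reverse, so the constraint sets
    can differ while defining the same colourings.\<close>
  then have "(\<forall>(a, b)\<in>D2 \<union> (\<lambda>v. (v, p v)) ` A. x a \<noteq> x b) \<longleftrightarrow> (\<forall>(a, b)\<in>links. x a \<noteq> x b)"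
    for x :: "'a \<Rightarrow> nat"
  proof -
    have "(\<forall>v\<in>B. x (p v) \<noteq> x v) \<longleftrightarrow> (\<forall>v\<in>B. x v \<noteq> x (p v))"
      by (intro ball_cong refl arg_cong[where f = Not] eq_commute)
    then show ?thesis unfolding \<open>leaves = _\<close> D2_def D1_def D0_def by (simp add: ball_Un)
  qed
  then have "colourings V r (D2 \<union> (\<lambda>v. (v, p v)) ` A) = colourings V r links"
    by (simp only: colourings_def)
  then have 3: "(r - 1) ^ card A * card (rainbow D2 e) \<le> r ^ card A * card (rainbow links e)"
    using 3 by simp
  have "card (leaves - C0) = card A + card B + card C"
    unfolding split using fin disj by (simp add: card_Un_disjoint)
  then have "(r - 1) ^ card (leaves - C0) * card (rainbow D0 e) =
      (r - 1) ^ card A * ((r - 1) ^ card C * ((r - 1) ^ card B * card (rainbow D0 e)))"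
    by (simp add: power_add mult_ac)
  also have "\<dots> \<le> (r - 1) ^ card A * ((r - 1) ^ card C * (r ^ card B * card (rainbow D1 e)))"
    using 1 by (intro mult_left_mono) auto
  also have "\<dots> = (r - 1) ^ card A * r ^ card B * ((r - 1) ^ card C * card (rainbow D1 e))"
    by (simp add: mult_ac)
  also have "\<dots> \<le> (r - 1) ^ card A * r ^ card B * (r ^ card C * card (rainbow D2 e))"
    using 2 by (intro mult_left_mono) auto
  also have "\<dots> = r ^ card B * r ^ card C * ((r - 1) ^ card A * card (rainbow D2 e))"
    by (simp add: mult_ac)
  also have "\<dots> \<le> r ^ card B * r ^ card C * (r ^ card A * card (rainbow links e))"
    using 3 by (intro mult_left_mono) auto
  also have "\<dots> = r ^ card (leaves - C0) * card (rainbow links e)"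
    using \<open>card (leaves - C0) = _\<close> by (simp add: power_add mult_ac)
  finally show ?thesis unfolding D0_def .
qed

text \<open>\<open>density\<close> is the probability that a uniform colouring shows all
  \<open>r\<close> colours on a given edge; \<open>gain\<close> bounds from below what one
  constraint inside the edge adds to it.\<close>

private definition "density = real (Stirling k r) * fact r / real r ^ k"
private definition "gain = real r / (real r ^ k * real (r - 1))"

section \<open>Averages over the constrained colourings\<close>

lemma card_colourings_real:
  "real (card (colourings V r links)) * real r ^ card leaves = real (r - 1) ^ card leaves * real r ^ card V"
  using arg_cong[OF card_colourings_links, of real] by (simp add: mult.commute)

lemma card_colourings_pos: "0 < card (colourings V r links)"
proof (rule ccontr)
  assume "\<not> ?thesis"
  then have "(r - 1) ^ card leaves * r ^ card V = 0" using card_colourings_links by simp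
  then show False using r by simp
qed

lemma card_unconstrained_rainbow:
  assumes "e \<in> E"
  shows "real (card (rainbow {} e)) = density * real r ^ card V"
proof -
  have "k \<le> card V" using assms card_edge edge_subset finite_V card_mono by metis
  then have "real r ^ card V = real r ^ k * real r ^ (card V - k)" by (simp flip: power_add)
  moreover have "card (rainbow {} e) = fact r * Stirling k r * r ^ (card V - k)"
    using card_rainbow[OF finite_V edge_subset[OF assms], of r] card_edge[OF assms] by simp
  ultimately show ?thesis using r by (simp add: density_def)
qed

text \<open>The case \<open>C0 = {}\<close> of \<open>card_rainbow_links\<close>, divided by the
  count in \<open>card_colourings_links\<close>.\<close>

lemma rainbow_average:
  assumes "e \<in> E"
  shows "density * card (colourings V r links) \<le> card (rainbow links e)"
proof -
  let ?l = "card leaves" and ?T = "real (card (colourings V r links))"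
  have "(r - 1) ^ ?l * card (rainbow {} e) \<le> r ^ ?l * card (rainbow links e)"
    using card_rainbow_links[OF assms, of "{}"] by simp
  then have "real (r - 1) ^ ?l * real (card (rainbow {} e)) \<le> real r ^ ?l * real (card (rainbow links e))"
    using of_nat_mono[where 'a = real] by (simp only: flip: of_nat_mult of_nat_power)
  also have "real (r - 1) ^ ?l * real (card (rainbow {} e)) = density * (?T * real r ^ ?l)"
    unfolding card_unconstrained_rainbow[OF assms] card_colourings_real by (simp add: mult_ac)
  finally have "real r ^ ?l * (density * ?T) \<le> real r ^ ?l * real (card (rainbow links e))"
    by (simp add: mult_ac)
  then show ?thesis using r by simp
qed

text \<open>Impose one constraint inside \<open>e\<close> first and keep the last term of
  \<open>card_colourings_insert\<close>, bounded by \<open>card_rainbow_lost\<close>. The other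
  leaves follow by \<open>card_rainbow_links\<close> with \<open>C0 = {u}\<close>.\<close>

lemma rainbow_average_split:
  assumes "e \<in> split_edges E p"
  shows "(density + gain) * card (colourings V r links) \<le> card (rainbow links e)"
proof -
  let ?l = "card leaves" and ?T = "real (card (colourings V r links))"
  obtain u where u: "u \<in> e" "p u \<noteq> u" "p u \<in> e" and e: "e \<in> E" using assms by (auto simp: split_edges_def)
  have eV: "e \<subseteq> V" "card e = k" using edge_subset card_edge e by auto
  have uL: "u \<in> leaves" using u eV by (auto simp: leaves_def)
  then obtain l where l: "?l = Suc l" using finite_leaves by (metis card_Suc_Diff1)
  have kV: "k \<le> card V" using eV finite_V card_mono by metis
  have "r * card (rainbow {(u, p u)} e) = (r - 1) * card (rainbow {} e) +
      card {x \<in> colourings V r {}. {..<r} \<subseteq> x ` e \<and> \<not> {..<r} \<subseteq> (x(u := x (p u))) ` e}"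
  proof (rule card_colourings_insert[OF finite_V])
    show "{..<r} \<subseteq> (x(u := c)) ` e" if "x u = x (p u)" "{..<r} \<subseteq> x ` e" for c and x :: "'a \<Rightarrow> nat"
    proof -
      have "x ` e \<subseteq> (x(u := c)) ` e" using that(1) u
        by (intro image_subsetI) (metis fun_upd_other imageI)
      then show ?thesis using that(2) by blast
    qed
  qed (use u uL leaf r in auto)
  also have "\<dots> \<ge> (r - 1) * card (rainbow {} e) + r * r ^ (card V - k)"
    using card_rainbow_lost[OF finite_V eV(1) u(1,3) u(2)[symmetric] r(1)] r(2) eV by simp
  finally have one: "(r - 1) * card (rainbow {} e) + r * r ^ (card V - k) \<le> r * card (rainbow {(u, p u)} e)" .
  have "(r - 1) ^ l * card (rainbow {(u, p u)} e) \<le> r ^ l * card (rainbow links e)"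
    using card_rainbow_links[OF e, of "{u}"] uL u l finite_leaves by simp
  then have "r * ((r - 1) ^ l * card (rainbow {(u, p u)} e)) \<le> r ^ ?l * card (rainbow links e)"
    using l by simp
  moreover have "(r - 1) ^ l * ((r - 1) * card (rainbow {} e) + r * r ^ (card V - k)) \<le>
      r * ((r - 1) ^ l * card (rainbow {(u, p u)} e))"
    using mult_left_mono[OF one, of "(r - 1) ^ l"] by (simp add: mult_ac)
  ultimately have "(r - 1) ^ l * ((r - 1) * card (rainbow {} e) + r * r ^ (card V - k)) \<le>
      r ^ ?l * card (rainbow links e)" by (rule order.trans[rotated])
  then have "real (r - 1) ^ l * (real (r - 1) * real (card (rainbow {} e)) + real r * real r ^ (card V - k))
      \<le> real r ^ ?l * real (card (rainbow links e))"
    using of_nat_mono[where 'a = real] by (simp only: flip: of_nat_mult of_nat_power of_nat_add)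
  also have "real (r - 1) ^ l * (real (r - 1) * real (card (rainbow {} e)) + real r * real r ^ (card V - k))
      = (density + gain) * (real (r - 1) ^ ?l * real r ^ card V)"
  proof -
    have "real r ^ card V = real r ^ k * real r ^ (card V - k)" using kV by (simp flip: power_add)
    \<comment> \<open>This identity dictates the value of \<open>gain\<close>.\<close>
    then have "real r * real r ^ (card V - k) = real (r - 1) * gain * real r ^ card V"
      using r by (simp add: gain_def)
    then show ?thesis unfolding card_unconstrained_rainbow[OF e] l by (simp add: algebra_simps)
  qed
  also have "\<dots> = (density + gain) * (?T * real r ^ ?l)"
    unfolding card_colourings_real ..
  finally have "real r ^ ?l * ((density + gain) * ?T) \<le> real r ^ ?l * real (card (rainbow links e))"
    by (simp add: mult_ac)
  then show ?thesis using r by simp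
qed

text \<open>Some constrained colouring has at least the average number of edges with all colours,
  and its colour classes are the cut.\<close>

lemma ex_cut_split_edges:
  "\<exists>P. is_cut r V P \<and> excess k r E P \<ge> real r / (real r ^ k * real (r - 1)) * card (split_edges E p)"
proof -
  let ?X = "colourings V r links"
  let ?m = "\<lambda>x. card {e \<in> E. {..<r} \<subseteq> x ` e}"
  have "(density * card E + gain * card (split_edges E p)) * card ?X =
      (\<Sum>e\<in>E. (density + (if e \<in> split_edges E p then gain else 0)) * card ?X)"
  proof -
    have "E \<inter> split_edges E p = split_edges E p" by (auto simp: split_edges_def)
    then have "(\<Sum>e\<in>E. density + (if e \<in> split_edges E p then gain else 0)) =
        density * card E + gain * card (split_edges E p)"
      using finite_E by (simp add: sum.distrib sum.If_cases mult.commute)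
    then show ?thesis by (simp flip: sum_distrib_right)
  qed
  also have "\<dots> \<le> (\<Sum>e\<in>E. real (card (rainbow links e)))"
    using rainbow_average rainbow_average_split by (intro sum_mono) auto
  \<comment> \<open>Double counting of pairs of a colouring and an edge on which it shows all
    colours.\<close>
  also have "\<dots> = (\<Sum>x\<in>?X. real (?m x))"
    using sum_multicount_gen[OF finite_colourings[OF finite_V] finite_E, of r links "\<lambda>x e. {..<r} \<subseteq> x ` e"
        "\<lambda>e. card (rainbow links e)"]
    by (simp flip: of_nat_sum)
  finally have avg: "(\<Sum>x\<in>?X. density * card E + gain * card (split_edges E p)) \<le> (\<Sum>x\<in>?X. real (?m x))"
    by (simp add: mult.commute)
  have "\<exists>x\<in>?X. density * card E + gain * card (split_edges E p) \<le> real (?m x)"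
  proof (rule ccontr)
    assume "\<not> ?thesis"
    then have "(\<Sum>x\<in>?X. real (?m x)) < (\<Sum>x\<in>?X. density * card E + gain * card (split_edges E p))"
      using card_colourings_pos by (intro sum_strict_mono) (auto simp: card_gt_0_iff not_le)
    then show False using avg by simp
  qed
  then obtain x where x: "x \<in> ?X" "density * card E + gain * card (split_edges E p) \<le> real (?m x)" by blast
  define P where "P i = {v \<in> V. x v = i}" for i
  have "x v < r" if "v \<in> V" for v using x(1) that by (auto simp: colourings_def)
  then have "is_cut r V P" by (auto simp: is_cut_def P_def disjoint_family_on_def)
  moreover have "{e \<in> E. \<forall>i<r. e \<inter> P i \<noteq> {}} = {e \<in> E. {..<r} \<subseteq> x ` e}"
    using edge_subset by (fastforce simp: P_def)
  then have "cut_size r E P = ?m x" by (simp add: cut_size_def)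
  ultimately show ?thesis
    using x(2) unfolding excess_def density_def gain_def by (intro exI[of _ P]) simp
qed

end

lemma ex_cut:
  assumes "2 \<le> r" "r \<le> k"
  shows "\<exists>P. is_cut r V P \<and>
    excess k r E P \<ge> real r / (real r ^ k * real (r - 1) * real (max k 3)) * card V"
proof -
  obtain p where p: "star_packing V E p" "card V \<le> max k 3 * card (split_edges E p)"
    by (rule ex_star_packing)
  obtain P where P: "is_cut r V P"
    "real r / (real r ^ k * real (r - 1)) * card (split_edges E p) \<le> excess k r E P"
    using ex_cut_split_edges[OF p(1) assms] by blast
  have "real (card V) / real (max k 3) \<le> card (split_edges E p)"
    using p(2) by (simp add: divide_le_eq mult.commute flip: of_nat_mult of_nat_le_iff)
  then have "real r / (real r ^ k * real (r - 1)) * (real (card V) / real (max k 3)) \<le>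
      real r / (real r ^ k * real (r - 1)) * card (split_edges E p)"
    by (intro mult_left_mono) auto
  then have "real r / (real r ^ k * real (r - 1) * real (max k 3)) * card V \<le> excess k r E P"
    using P(2) by (simp add: field_simps)
  then show ?thesis using P(1) by blast
qed

end

subsection \<open>Perfect matchings\<close>

text \<open>\<open>Stirling k 2\<close> is \<open>2 ^ (k - 1) - 1\<close>, the number of splittings
  of a \<open>k\<close>-set into two nonempty blocks.\<close>

lemma density_2:
  assumes "2 \<le> k"
  shows "real (Stirling k 2) * fact 2 / real 2 ^ k = 1 - 1 / 2 ^ (k - 1)"
proof -
  obtain m where k: "k = Suc m" using assms by (cases k) auto
  have "Stirling k 2 = 2 ^ m - 1" using Stirling_2[of m] by (simp add: k numeral_2_eq_2)
  then have "real (Stirling k 2) = 2 ^ m - 1" by (simp add: of_nat_diff)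
  then show ?thesis by (simp add: k field_simps)
qed

lemma excess_2:
  "2 \<le> k \<Longrightarrow> excess k 2 E P = real (cut_size 2 E P) - (1 - 1 / 2 ^ (k - 1)) * real (card E)"
  unfolding excess_def by (simp only: density_2)

lemma cut_size_le: "finite E \<Longrightarrow> cut_size r E P \<le> card E"
  unfolding cut_size_def by (intro card_mono) auto

text \<open>At best all edges are cut; perfect matchings attain this bound.\<close>

lemma excess_2_le:
  assumes "2 \<le> k" "finite E"
  shows "excess k 2 E P \<le> real (card E) / 2 ^ (k - 1)"
proof -
  have "real (cut_size 2 E P) \<le> real (card E)" using cut_size_le[OF assms(2), of 2 P] by simp
  then show ?thesis by (simp add: excess_2[OF assms(1)] algebra_simps)
qed

lemma perfect_matching_card:
  assumes "perfect_matching k V E" "2 \<le> k"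
  shows "finite E" "card V = k * card E"
proof -
  have V: "finite V" "\<And>e. e \<in> E \<Longrightarrow> e \<subseteq> V" "\<And>e. e \<in> E \<Longrightarrow> card e = k"
    and uniq: "\<And>v. v \<in> V \<Longrightarrow> \<exists>!e. e \<in> E \<and> v \<in> e"
    using assms(1) by (auto simp: perfect_matching_def uniform_hypergraph_def)
  show fin: "finite E" by (rule finite_subset[of _ "Pow V"]) (use V in auto)
  have "V = \<Union> E" using V(2) uniq by blast
  then have "card V = (\<Sum>e\<in>E. card e)"
    using fin uniq V(1,2)
    by (simp only:) (rule card_Union_disjoint, auto simp: pairwise_def disjnt_def intro: finite_subset)
  then show "card V = k * card E" using V(3) by simp
qed

text \<open>Choose two vertices in every edge and put exactly the first ones into part 0. The second
  ones avoid it because the edges are disjoint.\<close>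

lemma perfect_matching_cut:
  assumes "perfect_matching k V E" "2 \<le> k"
  obtains P where "is_cut 2 V P" "cut_size 2 E P = card E"
proof -
  have V: "\<And>e. e \<in> E \<Longrightarrow> e \<subseteq> V" "\<And>e. e \<in> E \<Longrightarrow> card e = k"
    and uniq: "\<And>v. v \<in> V \<Longrightarrow> \<exists>!e. e \<in> E \<and> v \<in> e"
    using assms(1) by (auto simp: perfect_matching_def uniform_hypergraph_def)
  have "\<exists>u w. u \<in> e \<and> w \<in> e \<and> u \<noteq> w" if e: "e \<in> E" for e
  proof -
    have "2 \<le> card e" using V(2)[OF e] assms(2) by simp
    then obtain T where "T \<subseteq> e" "card T = 2" by (rule obtain_subset_with_card_n)
    then show ?thesis unfolding card_2_iff by blast
  qed
  then obtain u w where uw: "\<And>e. e \<in> E \<Longrightarrow> u e \<in> e \<and> w e \<in> e \<and> u e \<noteq> w e" by metis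
  define P where "P i = (if i = 0 then u ` E else V - u ` E)" for i :: nat
  have "w e \<in> V - u ` E" if e: "e \<in> E" for e
  proof -
    have "w e \<in> V" using V(1)[OF e] uw[OF e] by blast
    moreover have "w e \<noteq> u f" if f: "f \<in> E" for f
    proof
      assume eq: "w e = u f"
      then have "e = f" using uniq[OF \<open>w e \<in> V\<close>] uw[OF e] uw[OF f] e f by auto
      then show False using uw[OF e] eq by simp
    qed
    ultimately show ?thesis by blast
  qed
  then have "u e \<in> e \<inter> P 0" "i \<noteq> 0 \<Longrightarrow> w e \<in> e \<inter> P i" if "e \<in> E" for e i
    using uw[OF that] that by (simp_all add: P_def)
  then have "e \<inter> P i \<noteq> {}" if "e \<in> E" for e i using that by (metis empty_iff)
  then have "{e \<in> E. \<forall>i<2. e \<inter> P i \<noteq> {}} = E" by blast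
  then have "cut_size 2 E P = card E" by (simp add: cut_size_def)
  moreover have "u ` E \<subseteq> V" using uw V(1) by blast
  then have "disjoint_family_on P {..<2}" "(\<Union>i<2. P i) = V"
    by (auto simp: P_def disjoint_family_on_def numeral_2_eq_2 lessThan_Suc)
  then have "is_cut 2 V P" by (simp add: is_cut_def)
  ultimately show ?thesis using that by simp
qed

lemma max_excess_perfect_matching:
  assumes "perfect_matching k V E" "2 \<le> k"
  shows "max_excess k 2 V E = real (card V) / (real k * 2 ^ (k - 1))"
proof -
  note card = perfect_matching_card[OF assms]
  obtain P where P: "is_cut 2 V P" "cut_size 2 E P = card E"
    by (rule perfect_matching_cut[OF assms])
  let ?X = "{excess k 2 E P | P. is_cut 2 V P}"
  \<comment> \<open>Finitely many sizes give finitely many excesses, so \<open>Max\<close> is the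
    true maximum.\<close>
  have "?X \<subseteq> (\<lambda>s. real s - real (Stirling k 2) * fact 2 / real 2 ^ k * real (card E)) ` {..card E}"
    using cut_size_le[OF card(1)] by (auto simp: excess_def)
  then have "finite ?X" by (rule finite_subset) simp
  moreover have "excess k 2 E P = real (card E) / 2 ^ (k - 1)"
    using P(2) by (simp add: excess_2[OF assms(2)] algebra_simps)
  ultimately have "Max ?X = real (card E) / 2 ^ (k - 1)"
    using P(1) excess_2_le[OF assms(2) card(1)] by (intro Max_eqI) (auto, metis)
  then show ?thesis using card(2) assms(2) by (simp add: max_excess_def)
qed

section \<open>Lower bounds on the excess and their sharpness\<close>

theorem theorem1p4:
  fixes k r :: nat
  assumes "2 \<le> r" and "r \<le> k"
  shows
    "(\<exists>c::real. c > 0 \<and>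
        (\<forall>(V::'a set) E. uniform_hypergraph k V E \<and> (\<forall>v\<in>V. \<not> isolated E v) \<longrightarrow>
          (\<exists>P. is_cut r V P \<and> excess k r E P \<ge> c * real (card V))))
     \<and> (k > 2 \<longrightarrow>
        (\<forall>(V::'a set) E. uniform_hypergraph k V E \<and> (\<forall>v\<in>V. \<not> isolated E v) \<longrightarrow>
          (\<exists>P. is_cut 2 V P \<and> excess k 2 E P \<ge> real (card V) / (real k * 2 ^ (k - 1)))))
     \<and> (\<forall>(V::'a set) E. perfect_matching k V E \<longrightarrow>
          max_excess k 2 V E = real (card V) / (real k * 2 ^ (k - 1)))
     \<and> (k > 2 \<longrightarrow>
        (\<forall>c'::real.
          (\<forall>(V::nat set) E. uniform_hypergraph k V E \<and> (\<forall>v\<in>V. \<not> isolated E v) \<longrightarrow>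
            (\<exists>P. is_cut 2 V P \<and> excess k 2 E P \<ge> c' * real (card V)))
          \<longrightarrow> c' \<le> 1 / (real k * 2 ^ (k - 1))))"
proof (intro conjI impI allI)
  have hyp: "hypergraph k V E" if "uniform_hypergraph k V E \<and> (\<forall>v\<in>V. \<not> isolated E v)"
    for V :: "'b set" and E
    using that assms by unfold_locales auto
  let ?c = "real r / (real r ^ k * real (r - 1) * real (max k 3))"
  have "0 < ?c" using assms by simp
  then show "\<exists>c::real. c > 0 \<and>
        (\<forall>(V::'a set) E. uniform_hypergraph k V E \<and> (\<forall>v\<in>V. \<not> isolated E v) \<longrightarrow>
          (\<exists>P. is_cut r V P \<and> excess k r E P \<ge> c * real (card V)))"
    using hypergraph.ex_cut[OF hyp assms] by (intro exI[of _ ?c]) blast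
next
  fix V :: "'a set" and E
  assume k: "k > 2" and H: "uniform_hypergraph k V E \<and> (\<forall>v\<in>V. \<not> isolated E v)"
  interpret hypergraph k V E using H k by unfold_locales auto
  \<comment> \<open>For \<open>k > 2\<close> the maximum is \<open>k\<close>, and
    \<open>2 / 2 ^ k\<close> is \<open>1 / 2 ^ (k - 1)\<close>.\<close>
  have "real 2 / (real 2 ^ k * real (2 - 1) * real (max k 3)) = 1 / (real k * 2 ^ (k - 1))"
    using k by (cases k) (auto simp: max_def)
  then show "\<exists>P. is_cut 2 V P \<and> excess k 2 E P \<ge> real (card V) / (real k * 2 ^ (k - 1))"
    using ex_cut[of 2] k by simp
next
  fix V :: "'a set" and E
  assume "perfect_matching k V E"
  then show "max_excess k 2 V E = real (card V) / (real k * 2 ^ (k - 1))"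
    by (rule max_excess_perfect_matching) (use assms in simp)
next
  fix c' :: real
  assume k: "k > 2" and "\<forall>(V::nat set) E. uniform_hypergraph k V E \<and> (\<forall>v\<in>V. \<not> isolated E v) \<longrightarrow>
            (\<exists>P. is_cut 2 V P \<and> excess k 2 E P \<ge> c' * real (card V))"
  \<comment> \<open>A single edge on \<open>k\<close> vertices, the smallest nonempty perfect
    matching, already bounds \<open>c'\<close>.\<close>
  moreover have "uniform_hypergraph k {..<k} {{..<k}} \<and> (\<forall>v\<in>{..<k}. \<not> isolated {{..<k}} v)"
    by (auto simp: uniform_hypergraph_def isolated_def)
  ultimately obtain P where "c' * real (card {..<k}) \<le> excess k 2 {{..<k}} P" by blast
  also have "\<dots> \<le> 1 / 2 ^ (k - 1)" using excess_2_le[of k "{{..<k}}" P] k by simp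
  finally show "c' \<le> 1 / (real k * 2 ^ (k - 1))" using k by (simp add: field_simps)
qed

end
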